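(* There is an algorithm that, given a hypergraph $\mathcal{H}=(\mathcal{V},\mathcal{E})$ with maximum degree $\Delta$ and a positive integer $k$, runs in $2^{\mathcal{O}(\Delta\log\Delta)}\cdot|\mathcal{H}|^{\mathcal{O}(1)}$ time and either outputs a shattered set of $\mathcal{H}$ of size $k-1$ or correctly certifies that $\mathcal{H}$ has no shattered set of size $k$.
   Context: For a hypergraph $\mathcal{H}=(\mathcal{V},\mathcal{E})$, $|\mathcal{H}|:=|\mathcal{V}|+|\mathcal{E}|$. For $v\in\mathcal{V}$, $\mathrm{inc}(v)$ is the set of hyperedges containing $v$, the degree of $v$ is $|\mathrm{inc}(v)|$, and $\Delta=\max_{v\in\mathcal{V}}|\mathrm{inc}(v)|$. A set $S\subseteq\mathcal{V}$ is shattered if for every $S'\subseteq S$ there is $e\in\mathcal{E}$ with $e\cap S=S'$. *)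

theory Defs
  imports Complex_Main "HOL-Library.Landau_Symbols"
begin

section \<open>Hypergraphs\<close>

definition hypergraph :: "'a set \<Rightarrow> 'a set set \<Rightarrow> bool" where
  "hypergraph V E \<longleftrightarrow> finite V \<and> (\<forall>e\<in>E. e \<subseteq> V)"

definition hsize :: "'a set \<Rightarrow> 'a set set \<Rightarrow> nat" where
  "hsize V E = card V + card E"

definition inc :: "'a set set \<Rightarrow> 'a \<Rightarrow> 'a set set" where
  "inc E v = {e \<in> E. v \<in> e}"

text \<open>Inserting 0 only matters for \<open>V = {}\<close>, where the maximum degree is taken to be 0.\<close>

definition max_degree :: "'a set \<Rightarrow> 'a set set \<Rightarrow> nat" where
  "max_degree V E = Max (insert 0 ((\<lambda>v. card (inc E v)) ` V))"

definition shattered :: "'a set \<Rightarrow> 'a set set \<Rightarrow> 'a set \<Rightarrow> bool" where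
  "shattered V E S \<longleftrightarrow> S \<subseteq> V \<and> (\<forall>S'\<subseteq>S. \<exists>e\<in>E. e \<inter> S = S')"

section \<open>Model of computation\<close>

text \<open>
  Algorithms are programs of a first-order, call-by-value functional language over binary trees
  (pure first-order Lisp with a single atom). There are no primitives besides constructing,
  destructing and testing a single tree node, and each of them costs one time unit. Representing
  trees by pointers, a Turing machine or a RAM simulates such programs with polynomial overhead,
  and conversely, so a bound that is closed under polynomials does not depend on this choice.
\<close>

datatype tree = Leaf | Node tree tree

fun left :: "tree \<Rightarrow> tree" where
  "left Leaf = Leaf"
| "left (Node l r) = l"

fun right :: "tree \<Rightarrow> tree" where
  "right Leaf = Leaf"
| "right (Node l r) = r"

text \<open>
  \<open>Arg i\<close> is the \<open>i\<close>-th argument of the function being executed (counting from 0);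
  \<open>Cond\<close> treats \<open>Leaf\<close> as false and every other tree as true.
\<close>

datatype expr =
    Arg nat
  | LeafE
  | NodeE expr expr
  | LeftE expr
  | RightE expr
  | Cond expr expr expr
  | Call nat "expr list"

text \<open>A program is the list of its function bodies, which may be mutually recursive.\<close>

type_synonym program = "expr list"

text \<open>
  \<open>eval P xs e v t\<close>: in the program \<open>P\<close>, with actual arguments \<open>xs\<close>, the evaluation of \<open>e\<close>
  terminates with value \<open>v\<close> after \<open>t\<close> time units.
\<close>

inductive eval :: "program \<Rightarrow> tree list \<Rightarrow> expr \<Rightarrow> tree \<Rightarrow> nat \<Rightarrow> bool"
  and evals :: "program \<Rightarrow> tree list \<Rightarrow> expr list \<Rightarrow> tree list \<Rightarrow> nat \<Rightarrow> bool"
  for P :: program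
where
  eval_Arg: "i < length xs \<Longrightarrow> eval P xs (Arg i) (xs ! i) 1"
| eval_Leaf: "eval P xs LeafE Leaf 1"
| eval_Node: "\<lbrakk>eval P xs a u s; eval P xs b v t\<rbrakk>
    \<Longrightarrow> eval P xs (NodeE a b) (Node u v) (s + t + 1)"
| eval_Left: "eval P xs a v t \<Longrightarrow> eval P xs (LeftE a) (left v) (t + 1)"
| eval_Right: "eval P xs a v t \<Longrightarrow> eval P xs (RightE a) (right v) (t + 1)"
| eval_Cond_true: "\<lbrakk>eval P xs c w s; w \<noteq> Leaf; eval P xs a v t\<rbrakk>
    \<Longrightarrow> eval P xs (Cond c a b) v (s + t + 1)"
| eval_Cond_false: "\<lbrakk>eval P xs c Leaf s; eval P xs b v t\<rbrakk>
    \<Longrightarrow> eval P xs (Cond c a b) v (s + t + 1)"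
| eval_Call: "\<lbrakk>i < length P; evals P xs as ys s; eval P ys (P ! i) v t\<rbrakk>
    \<Longrightarrow> eval P xs (Call i as) v (s + t + 1)"
| evals_Nil: "evals P xs [] [] 0"
| evals_Cons: "\<lbrakk>eval P xs a v s; evals P xs as vs t\<rbrakk>
    \<Longrightarrow> evals P xs (a # as) (v # vs) (s + t)"

text \<open>The function with index 0 is the main function; it receives the input as its only argument.\<close>

definition run :: "program \<Rightarrow> tree \<Rightarrow> tree \<Rightarrow> nat \<Rightarrow> bool" where
  "run P input output t \<longleftrightarrow> eval P [input] (Call 0 [Arg 0]) output t"

inductive_cases eval_ArgE: "eval P xs (Arg i) v t"
inductive_cases eval_LeafE: "eval P xs LeafE v t"
inductive_cases eval_NodeE: "eval P xs (NodeE a b) v t"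
inductive_cases eval_LeftE: "eval P xs (LeftE a) v t"
inductive_cases eval_RightE: "eval P xs (RightE a) v t"
inductive_cases eval_CondE: "eval P xs (Cond c a b) v t"
inductive_cases eval_CallE: "eval P xs (Call i as) v t"
inductive_cases evals_NilE: "evals P xs [] vs t"
inductive_cases evals_ConsE: "evals P xs (a # as) vs t"

lemma eval_deterministic:
  "eval P xs e v t \<Longrightarrow> eval P xs e v' t' \<Longrightarrow> v' = v \<and> t' = t"
  "evals P xs es vs t \<Longrightarrow> evals P xs es vs' t' \<Longrightarrow> vs' = vs \<and> t' = t"
proof (induction arbitrary: v' t' and vs' t' rule: eval_evals.inducts)
  case eval_Arg
  from eval_Arg.prems show ?case by (rule eval_ArgE) simp
next
  case eval_Leaf
  from eval_Leaf.prems show ?case by (rule eval_LeafE) simp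
next
  case eval_Node
  from eval_Node.prems show ?case
    by (rule eval_NodeE) (use eval_Node.IH in \<open>metis Suc_eq_plus1\<close>)+
next
  case eval_Left
  from eval_Left.prems show ?case
    by (rule eval_LeftE) (use eval_Left.IH in \<open>metis Suc_eq_plus1\<close>)+
next
  case eval_Right
  from eval_Right.prems show ?case
    by (rule eval_RightE) (use eval_Right.IH in \<open>metis Suc_eq_plus1\<close>)+
next
  case eval_Cond_true
  from eval_Cond_true.prems show ?case
    by (rule eval_CondE) (use eval_Cond_true.IH eval_Cond_true.hyps in \<open>metis Suc_eq_plus1\<close>)+
next
  case eval_Cond_false
  from eval_Cond_false.prems show ?case
    by (rule eval_CondE) (use eval_Cond_false.IH in \<open>metis Suc_eq_plus1\<close>)+
next
  case eval_Call
  from eval_Call.prems show ?case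
    by (rule eval_CallE) (use eval_Call.IH in \<open>metis Suc_eq_plus1\<close>)+
next
  case evals_Nil
  from evals_Nil.prems show ?case by (rule evals_NilE) simp
next
  case evals_Cons
  from evals_Cons.prems show ?case
    by (rule evals_ConsE) (use evals_Cons.IH in \<open>metis Suc_eq_plus1\<close>)+
qed

lemma run_deterministic:
  "run P input v t \<Longrightarrow> run P input v' t' \<Longrightarrow> v' = v \<and> t' = t"
  unfolding run_def by (rule eval_deterministic(1))

section \<open>Encoding of inputs and outputs\<close>

fun enc_list :: "tree list \<Rightarrow> tree" where
  "enc_list [] = Leaf"
| "enc_list (x # xs) = Node x (enc_list xs)"

definition enc_bool :: "bool \<Rightarrow> tree" where
  "enc_bool b = (if b then Node Leaf Leaf else Leaf)"

text \<open>Binary representation, least significant bit first, without leading zeros.\<close>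

fun bits :: "nat \<Rightarrow> bool list" where
  "bits n = (if n = 0 then [] else odd n # bits (n div 2))"

declare bits.simps [simp del]

definition enc_nat :: "nat \<Rightarrow> tree" where
  "enc_nat n = enc_list (map enc_bool (bits n))"

text \<open>A set of vertices is encoded by its characteristic vector relative to an enumeration
  \<open>vs\<close> of the vertices.\<close>

definition enc_set :: "'a list \<Rightarrow> 'a set \<Rightarrow> tree" where
  "enc_set vs S = enc_list (map (\<lambda>v. enc_bool (v \<in> S)) vs)"

text \<open>
  A hypergraph with vertices enumerated by \<open>vs\<close> and hyperedges enumerated by \<open>es\<close> is given as its
  incidence matrix, one row for each hyperedge. The number of vertices, which the matrix does not
  determine if there are no hyperedges, is given separately in unary.
\<close>

definition enc_instance :: "'a list \<Rightarrow> 'a set list \<Rightarrow> nat \<Rightarrow> tree" where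
  "enc_instance vs es k =
     enc_list [enc_list (map (\<lambda>_. Leaf) vs), enc_list (map (enc_set vs) es), enc_nat k]"

text \<open>The answer is either a set of vertices or the verdict that there is no shattered set of the
  requested size.\<close>

fun enc_answer :: "'a list \<Rightarrow> 'a set option \<Rightarrow> tree" where
  "enc_answer vs None = Leaf"
| "enc_answer vs (Some S) = Node Leaf (enc_set vs S)"

end

theory Submission
  imports Defs
begin

text \<open>
  If \<open>W\<close> is shattered and \<open>w \<in> W\<close>, then \<open>W - {w}\<close> is already shattered by the at most \<open>\<Delta>\<close>
  hyperedges containing \<open>w\<close>. So it suffices to search, for every vertex \<open>w\<close>, for a set of size
  \<open>k - 1\<close> shattered by \<open>inc E w\<close>. For this search a vertex \<open>v\<close> only matters through its trace
  \<open>inc E w \<inter> inc E v\<close>, and there are at most \<open>2 ^ \<Delta>\<close> different traces. A set of traces is grown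
  one by one, keeping it shattered; since a set of size \<open>i\<close> needs \<open>2 ^ i\<close> hyperedges, the depth of
  the search is at most \<open>log \<Delta>\<close>, and it visits \<open>(2 ^ \<Delta>) ^ O(log \<Delta>)\<close> nodes.
\<close>

section \<open>The search and its correctness\<close>

text \<open>Passing from W to \<open>W - {w}\<close> is the only lossy step, and it is why the
  answer has size k - 1 while the certificate speaks of size k. A set that the search returns is
  really shattered, but nothing guarantees that it extends by one more vertex.

  The search exchanges the roles of vertices and hyperedges: the hyperedges through w are the points
  and the traces are the sets. Traces fit together when they are independent, that is, when every
  choice of each trace or its complement still leaves a point of m; \<open>splits\<close> tests this
  by cutting m in two again and again. Such a test is exponential in the number of traces, but an
  independent family is logarithmically small, so the test is polynomial in the number of
  hyperedges. Only the branching of the search may cost more.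

  Equal traces are never independent, so vertices with the same trace are interchangeable and one
  representative suffices. Erased representatives stay in the list, but the search merely walks past
  them: they contribute a linear factor and do not enter the base of the exponential.\<close>

fun splits :: "'e set list \<Rightarrow> 'e set \<Rightarrow> bool" where
  "splits [] m \<longleftrightarrow> m \<noteq> {}"
| "splits (c # cs) m \<longleftrightarrow> splits cs (m \<inter> c) \<and> splits cs (m - c)"

text \<open>The two halves of m are disjoint, so each further set doubles the number of points
  required. This caps both the depth of the search and the price of a test.\<close>

lemma splits_card: "splits cs m \<Longrightarrow> finite m \<Longrightarrow> 2 ^ length cs \<le> card m"
proof (induction cs arbitrary: m)
  case Nil
  then show ?case by (simp add: Suc_leI card_gt_0_iff)
next
  case (Cons c cs)
  have "card m = card (m \<inter> c) + card (m - c)"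
    using Cons.prems(2) by (metis card_Int_Diff)
  moreover have "2 ^ length cs \<le> card (m \<inter> c)" "2 ^ length cs \<le> card (m - c)"
    using Cons by auto
  ultimately show ?case by simp
qed

text \<open>The order-free counterpart of \<open>splits\<close>: points are hyperedges, and every
  membership pattern on \<open>C\<close> has to be realised by a point of m.\<close>

definition dual_shattered :: "'e set set \<Rightarrow> 'e set \<Rightarrow> bool" where
  "dual_shattered C m \<longleftrightarrow> (\<forall>T\<subseteq>C. \<exists>e\<in>m. {c \<in> C. e \<in> c} = T)"

lemma dual_shattered_mono: "dual_shattered D m \<Longrightarrow> C \<subseteq> D \<Longrightarrow> dual_shattered C m"
  unfolding dual_shattered_def
proof (intro allI impI)
  fix T assume *: "\<forall>T\<subseteq>D. \<exists>e\<in>m. {c \<in> D. e \<in> c} = T" "C \<subseteq> D" "T \<subseteq> C"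
  then obtain e where "e \<in> m" "{c \<in> D. e \<in> c} = T" by (meson order_trans)
  with * show "\<exists>e\<in>m. {c \<in> C. e \<in> c} = T" by (intro bexI[of _ e]) auto
qed

text \<open>Patterns that contain c can only be realised inside c, all others only outside, so the
  two halves of m may be treated separately.\<close>

lemma dual_shattered_insert:
  assumes "c \<notin> C"
  shows "dual_shattered (insert c C) m \<longleftrightarrow> dual_shattered C (m \<inter> c) \<and> dual_shattered C (m - c)"
    (is "?L \<longleftrightarrow> ?A \<and> ?B")
proof
  assume L: ?L
  show "?A \<and> ?B" unfolding dual_shattered_def
  proof (intro conjI allI impI)
    fix T assume T: "T \<subseteq> C"
    then obtain e where "e \<in> m" "{d \<in> insert c C. e \<in> d} = insert c T"
      using L unfolding dual_shattered_def by (meson insert_mono)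
    with assms T show "\<exists>e\<in>m \<inter> c. {d \<in> C. e \<in> d} = T" by (intro bexI[of _ e]) auto
    obtain e where "e \<in> m" "{d \<in> insert c C. e \<in> d} = T"
      using L T unfolding dual_shattered_def by (meson subset_insertI2)
    with assms T show "\<exists>e\<in>m - c. {d \<in> C. e \<in> d} = T" by (intro bexI[of _ e]) auto
  qed
next
  assume AB: "?A \<and> ?B"
  show ?L unfolding dual_shattered_def
  proof (intro allI impI)
    fix T assume T: "T \<subseteq> insert c C"
    then have "T - {c} \<subseteq> C" by auto
    show "\<exists>e\<in>m. {d \<in> insert c C. e \<in> d} = T"
    proof (cases "c \<in> T")
      case True
      obtain e where "e \<in> m \<inter> c" "{d \<in> C. e \<in> d} = T - {c}"
        using AB \<open>T - {c} \<subseteq> C\<close> unfolding dual_shattered_def by meson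
      with True show ?thesis by (intro bexI[of _ e]) auto
    next
      case False
      obtain e where "e \<in> m - c" "{d \<in> C. e \<in> d} = T - {c}"
        using AB \<open>T - {c} \<subseteq> C\<close> unfolding dual_shattered_def by meson
      with False show ?thesis by (intro bexI[of _ e]) auto
    qed
  qed
qed

lemma not_splits_empty: "\<not> splits cs {}"
  by (induction cs) auto

text \<open>When c comes up for splitting, the half inside c is empty, and an empty half can never
  be split further. With \<open>m - c\<close> for m, this is what makes the test reject repeated
  sets.\<close>

lemma not_splits_if_disjoint: "m \<inter> c = {} \<Longrightarrow> c \<in> set cs \<Longrightarrow> \<not> splits cs m"
proof (induction cs arbitrary: m)
  case (Cons d cs)
  show ?case
  proof (cases "c = d")
    case True
    then show ?thesis using Cons.prems(1) not_splits_empty by auto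
  next
    case False
    then have "\<not> splits cs (m \<inter> d)" using Cons.prems by (intro Cons.IH) auto
    then show ?thesis by simp
  qed
qed simp

text \<open>Trades the test on lists for a condition on sets: soundness reads off that the chosen
  traces are distinct, completeness passes to subfamilies.\<close>

lemma splits_iff: "splits cs m \<longleftrightarrow> distinct cs \<and> dual_shattered (set cs) m"
proof (induction cs arbitrary: m)
  case Nil
  show ?case by (auto simp: dual_shattered_def)
next
  case (Cons c cs)
  show ?case
  proof (cases "c \<in> set cs")
    case True
    then have "\<not> splits cs (m - c)" by (intro not_splits_if_disjoint) auto
    with True show ?thesis by simp
  next
    case False
    then show ?thesis by (auto simp: Cons.IH dual_shattered_insert)
  qed
qed

section \<open>Backtracking over traces\<close>

fun search :: "('a \<times> 'e set option) list \<Rightarrow> 'e set list \<Rightarrow> 'e set \<Rightarrow> nat \<Rightarrow> 'a set option" where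
  "search [] cs m u = (if u = 0 then Some {} else None)"
| "search ((v, x) # ps) cs m u =
     (case (case x of
              None \<Rightarrow> None
            | Some c \<Rightarrow> if u \<noteq> 0 \<and> splits (c # cs) m then search ps (c # cs) m (u - 1) else None) of
        Some W \<Rightarrow> Some (insert v W)
      | None \<Rightarrow> search ps cs m u)"

lemma search_sound:
  assumes "search ps cs m u = Some W" "splits cs m" "distinct (map fst ps)"
    and "\<And>v c. (v, Some c) \<in> set ps \<Longrightarrow> c = col v"
  shows "\<exists>ws. set ws = W \<and> length ws = u \<and> distinct ws \<and> W \<subseteq> fst ` set ps \<and>
           splits (map col ws @ cs) m"
  using assms
proof (induction ps arbitrary: cs u W)
  case Nil
  then show ?case by (auto split: if_splits)
next
  case (Cons p ps)
  obtain v x where p: "p = (v, x)" by fastforce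
  have dist: "distinct (map fst ps)" and col: "\<And>v c. (v, Some c) \<in> set ps \<Longrightarrow> c = col v"
    using Cons.prems(3,4) by auto
  consider c W' where "x = Some c" "u \<noteq> 0" "splits (c # cs) m"
      "search ps (c # cs) m (u - 1) = Some W'" "W = insert v W'"
    | "search ps cs m u = Some W"
    using Cons.prems(1) unfolding p by (auto split: option.splits if_splits)
  then show ?case
  proof cases
    case 1
    have c: "c = col v" using Cons.prems(4)[of v c] 1 p by simp
    obtain ws where ws: "set ws = W'" "length ws = u - 1" "distinct ws" "W' \<subseteq> fst ` set ps"
      "splits (map col ws @ c # cs) m"
      using Cons.IH[OF 1(4,3) dist col] by blast
    moreover have "v \<notin> W'" using ws(4) Cons.prems(3) p by auto
    \<comment> \<open>Traces are pushed onto the front of the accumulator, so v, chosen before all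
      of \<open>ws\<close>, comes last.\<close>
    ultimately show ?thesis using 1 c p
      by (intro exI[of _ "ws @ [v]"]) auto
  next
    case 2
    show ?thesis using Cons.IH[OF 2 Cons.prems(2) dist col] p by auto
  qed
qed

text \<open>\<open>C\<close> holds the traces of a solution that are still to be picked. If the head
  carries one of them, the branch that takes it succeeds with the rest of \<open>C\<close>;
  otherwise all of \<open>C\<close> is still found in the tail. An earlier success with another set
  does no harm, since only \<open>None\<close> has to be excluded.\<close>

lemma search_complete:
  assumes "card C = u" "finite C" "\<forall>c\<in>C. Some c \<in> snd ` set ps" "C \<inter> set cs = {}"
    "distinct cs" "dual_shattered (C \<union> set cs) m"
  shows "search ps cs m u \<noteq> None"
  using assms
proof (induction ps arbitrary: C cs u)
  case Nil
  then have "C = {}" by auto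
  with Nil show ?case by auto
next
  case (Cons p ps)
  obtain v x where p: "p = (v, x)" by fastforce
  show ?case
  proof (cases "\<exists>c. x = Some c \<and> c \<in> C")
    case True
    then obtain c where c: "x = Some c" "c \<in> C" by blast
    have "u \<noteq> 0" using c Cons.prems by auto
    have "dual_shattered (set (c # cs)) m"
      by (rule dual_shattered_mono[OF Cons.prems(6)]) (use c in auto)
    then have sp: "splits (c # cs) m" using c Cons.prems by (subst splits_iff) auto
    have "search ps (c # cs) m (u - 1) \<noteq> None"
    proof (rule Cons.IH[of "C - {c}"])
      show "dual_shattered (C - {c} \<union> set (c # cs)) m"
        by (rule dual_shattered_mono[OF Cons.prems(6)]) (use c in auto)
    qed (use c p Cons.prems in \<open>auto simp: card_Diff_singleton\<close>)
    then show ?thesis using c p sp \<open>u \<noteq> 0\<close> by auto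
  next
    case False
    have "search ps cs m u \<noteq> None"
      by (rule Cons.IH[OF Cons.prems(1,2) _ Cons.prems(4,5,6)])
         (use False p Cons.prems(3) in auto)
    then show ?thesis using p by (auto split: option.splits)
  qed
qed

section \<open>Removing repeated traces\<close>

text \<open>Later occurrences of an entry are overwritten by \<open>z\<close> instead of being removed, so that
  positions keep corresponding to vertices.\<close>

fun dedup :: "'b \<Rightarrow> 'b list \<Rightarrow> 'b list" where
  "dedup z [] = []"
| "dedup z (x # xs) = x # dedup z (map (\<lambda>y. if x = y then z else y) xs)"

lemma length_dedup [simp]: "length (dedup z xs) = length xs"
  by (induction z xs rule: dedup.induct) auto

text \<open>The program compares encodings, not sets. Injectivity has to include \<open>z\<close>,
  so that no genuine entry is encoded like an erased one.\<close>

lemma map_dedup: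
  "inj_on f (insert z (set xs)) \<Longrightarrow> map f (dedup z xs) = dedup (f z) (map f xs)"
proof (induction z xs rule: dedup.induct)
  case (2 z x xs)
  let ?ys = "map (\<lambda>y. if x = y then z else y) xs"
  have "inj_on f (insert z (set ?ys))"
    by (rule inj_on_subset[OF "2.prems"]) auto
  then have "map f (dedup z ?ys) = dedup (f z) (map f ?ys)"
    by (rule "2.IH")
  also have "map f ?ys = map (\<lambda>y. if f x = y then f z else y) (map f xs)"
    using "2.prems" by (auto simp: inj_on_def)
  finally show ?case by (simp only: dedup.simps list.map)
qed simp

text \<open>Completeness needs that no trace is lost; \<open>z\<close> stands on both sides because
  erasing may introduce it.\<close>

lemma set_dedup: "insert z (set (dedup z xs)) = insert z (set xs)"
proof (induction z xs rule: dedup.induct)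
  case (2 z x xs)
  have "insert z (set (dedup z (x # xs))) =
      insert x (insert z (set (map (\<lambda>y. if x = y then z else y) xs)))"
    using "2.IH" by auto
  then show ?case by auto
qed simp

text \<open>Soundness needs that a surviving trace still belongs to the vertex at its
  position.\<close>

lemma dedup_nth: "i < length xs \<Longrightarrow> dedup z xs ! i = z \<or> dedup z xs ! i = xs ! i"
proof (induction z xs arbitrary: i rule: dedup.induct)
  case (2 z x xs)
  show ?case
  proof (cases i)
    case (Suc j)
    then have "j < length xs" using "2.prems" by simp
    then show ?thesis using "2.IH"[of j] Suc by (cases "x = xs ! j") auto
  qed simp
qed simp

text \<open>Bounds the entries on which the search can branch. A head other than \<open>z\<close> is
  erased from the rest, so the rest is counted in a set without it.\<close>

lemma length_filter_dedup: "length (filter (\<lambda>y. y \<noteq> z) (dedup z xs)) \<le> card (set xs - {z})"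
proof (induction z xs rule: dedup.induct)
  case (2 z x xs)
  let ?ys = "map (\<lambda>y. if x = y then z else y) xs"
  show ?case
  proof (cases "x = z")
    case True
    then have "?ys = xs" by (simp add: map_idI)
    then have "length (filter (\<lambda>y. y \<noteq> z) (dedup z xs)) \<le> card (set xs - {z})"
      using "2.IH" by metis
    with True \<open>?ys = xs\<close> show ?thesis by simp
  next
    case False
    have "length (filter (\<lambda>y. y \<noteq> z) (dedup z ?ys)) \<le> card (set ?ys - {z})"
      by (rule "2.IH")
    also have "\<dots> \<le> card (set (x # xs) - {z} - {x})"
      by (intro card_mono) auto
    also have "\<dots> < card (set (x # xs) - {z})"
      using False by (intro psubset_card_mono) auto
    finally show ?thesis using False by (simp only: dedup.simps filter.simps) simp
  qed
qed simp

section \<open>Trying every vertex as the dropped one\<close>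

definition candidates :: "'a set set \<Rightarrow> 'a list \<Rightarrow> 'a \<Rightarrow> ('a \<times> 'a set set option) list" where
  "candidates E vs w = zip vs (dedup None (map (\<lambda>v. Some (inc E w \<inter> inc E v)) vs))"

text \<open>Vertices of degree 0 must be skipped: for u = 0 the search answers
  \<open>Some {}\<close> without looking at m, which would be wrong if there are no hyperedges at
  all.\<close>

fun scan :: "'a set set \<Rightarrow> 'a list \<Rightarrow> nat \<Rightarrow> 'a list \<Rightarrow> 'a set option" where
  "scan E vs u [] = None"
| "scan E vs u (w # ws) =
     (case (if inc E w \<noteq> {} then search (candidates E vs w) [] (inc E w) u else None) of
        Some W \<Rightarrow> Some W
      | None \<Rightarrow> scan E vs u ws)"

lemma map_fst_candidates [simp]: "map fst (candidates E vs w) = vs"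
  by (simp add: candidates_def)

lemma candidates_Some: "(v, Some c) \<in> set (candidates E vs w) \<Longrightarrow> c = inc E w \<inter> inc E v"
proof -
  let ?cols = "map (\<lambda>v. Some (inc E w \<inter> inc E v)) vs"
  assume "(v, Some c) \<in> set (candidates E vs w)"
  then obtain i where i: "i < length vs" "vs ! i = v" "dedup None ?cols ! i = Some c"
    unfolding candidates_def in_set_zip by auto
  then show ?thesis using dedup_nth[of i ?cols None] by simp
qed

lemma scan_sound:
  assumes "scan E vs u ws = Some W" "distinct vs"
  shows "shattered (set vs) E W \<and> card W = u"
  using assms(1)
proof (induction ws)
  case (Cons w ws)
  let ?col = "\<lambda>v. inc E w \<inter> inc E v"
  consider "scan E vs u ws = Some W"
    | "inc E w \<noteq> {}" "search (candidates E vs w) [] (inc E w) u = Some W"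
    using Cons.prems by (auto split: option.splits if_splits)
  then show ?case
  proof cases
    case 1
    then show ?thesis by (rule Cons.IH)
  next
    case 2
    have "distinct (map fst (candidates E vs w))" using assms(2) by simp
    then obtain ws' where ws': "set ws' = W" "length ws' = u" "distinct ws'"
        "W \<subseteq> fst ` set (candidates E vs w)" "splits (map ?col ws') (inc E w)"
      using search_sound[OF 2(2), where col = ?col] 2(1) candidates_Some[of _ _ E vs w] by auto
    \<comment> \<open>Independence makes the traces pairwise distinct, so a pattern of traces
      determines a pattern of vertices.\<close>
    have inj: "inj_on ?col W" and sh: "dual_shattered (?col ` W) (inc E w)"
      using ws' by (auto simp: splits_iff distinct_map)
    have "shattered (set vs) E W" unfolding shattered_def
    proof (intro conjI allI impI)
      show "W \<subseteq> set vs" using ws'(4) by (metis list.set_map map_fst_candidates)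
      fix S' assume S': "S' \<subseteq> W"
      then obtain e where e: "e \<in> inc E w" "{c \<in> ?col ` W. e \<in> c} = ?col ` S'"
        using sh unfolding dual_shattered_def by (meson image_mono)
      have "v \<in> e \<longleftrightarrow> v \<in> S'" if "v \<in> W" for v
      proof -
        have "v \<in> e \<longleftrightarrow> e \<in> ?col v" using e(1) by (auto simp: inc_def)
        also have "\<dots> \<longleftrightarrow> ?col v \<in> ?col ` S'" using e(2) that by blast
        also have "\<dots> \<longleftrightarrow> v \<in> S'" by (rule inj_on_image_mem_iff[OF inj that S'])
        finally show ?thesis .
      qed
      then have "e \<inter> W = S'" using S' by auto
      then show "\<exists>e\<in>E. e \<inter> W = S'" using e(1) by (auto simp: inc_def)
    qed
    moreover have "card W = u" using ws' distinct_card by metis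
    ultimately show ?thesis by blast
  qed
qed simp

lemma scan_None:
  "scan E vs u ws = None \<Longrightarrow> w \<in> set ws \<Longrightarrow> inc E w \<noteq> {} \<Longrightarrow>
     search (candidates E vs w) [] (inc E w) u = None"
  by (induction ws) (auto split: option.splits if_splits)

lemma scan_complete:
  assumes "shattered (set vs) E W" "card W = Suc u"
  shows "scan E vs u vs \<noteq> None"
proof
  assume none: "scan E vs u vs = None"
  have fin: "finite W" using assms(2) by (metis Zero_not_Suc card.infinite)
  obtain w where w: "w \<in> W" using assms(2) by fastforce
  let ?col = "\<lambda>v. inc E w \<inter> inc E v"
  \<comment> \<open>Only patterns containing w are asked for; a hyperedge realising one of them
    necessarily passes through w.\<close>
  have sh: "\<exists>e\<in>inc E w. e \<inter> W = insert w T" if "T \<subseteq> W" for T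
  proof -
    have "insert w T \<subseteq> W" using w that by blast
    then obtain e where "e \<in> E" "e \<inter> W = insert w T"
      using assms(1) unfolding shattered_def by blast
    then show ?thesis by (intro bexI[of _ e]) (auto simp: inc_def)
  qed
  \<comment> \<open>The hyperedge that meets W in w and x alone tells the trace of x from that of
    any other vertex of W except w.\<close>
  have "inj_on ?col (W - {w})"
  proof (rule inj_onI)
    fix x y assume xy: "x \<in> W - {w}" "y \<in> W - {w}" "?col x = ?col y"
    then obtain e where e: "e \<in> inc E w" "e \<inter> W = insert w {x}" using sh[of "{x}"] by auto
    then have "e \<in> ?col x" by (auto simp: inc_def)
    then have "e \<in> ?col y" using xy(3) by simp
    then have "y \<in> e" by (simp add: inc_def)
    then show "x = y" using e(2) xy by auto
  qed
  then have card: "card (?col ` (W - {w})) = u"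
    using assms(2) w fin by (simp add: card_image)
  have "dual_shattered (?col ` (W - {w})) (inc E w)" unfolding dual_shattered_def
  proof (intro allI impI)
    fix T assume T: "T \<subseteq> ?col ` (W - {w})"
    obtain e where e: "e \<in> inc E w" "e \<inter> W = insert w {v \<in> W - {w}. ?col v \<in> T}"
      using sh[of "{v \<in> W - {w}. ?col v \<in> T}"] by auto
    have *: "e \<in> ?col v \<longleftrightarrow> ?col v \<in> T" if "v \<in> W - {w}" for v
    proof -
      have "e \<in> ?col v \<longleftrightarrow> v \<in> e \<inter> W" using e(1) that by (auto simp: inc_def)
      then show ?thesis using that unfolding e(2) by auto
    qed
    have "{c \<in> ?col ` (W - {w}). e \<in> c} = T"
    proof (intro equalityI subsetI)
      fix c assume "c \<in> {c \<in> ?col ` (W - {w}). e \<in> c}"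
      then obtain v where "v \<in> W - {w}" "c = ?col v" "e \<in> c" by blast
      then show "c \<in> T" using * by blast
    next
      fix c assume "c \<in> T"
      moreover then obtain v where "v \<in> W - {w}" "c = ?col v" using T by blast
      ultimately show "c \<in> {c \<in> ?col ` (W - {w}). e \<in> c}" using * by blast
    qed
    then show "\<exists>e\<in>inc E w. {c \<in> ?col ` (W - {w}). e \<in> c} = T" using e(1) by blast
  qed
  moreover have "\<forall>c\<in>?col ` (W - {w}). Some c \<in> snd ` set (candidates E vs w)"
  proof
    fix c assume c: "c \<in> ?col ` (W - {w})"
    have "W \<subseteq> set vs" using assms(1) by (simp add: shattered_def)
    with c have "Some c \<in> set (map (\<lambda>v. Some (?col v)) vs)" by auto
    then have "Some c \<in> set (dedup None (map (\<lambda>v. Some (?col v)) vs))"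
      using set_dedup[of None "map (\<lambda>v. Some (?col v)) vs"] by blast
    then show "Some c \<in> snd ` set (candidates E vs w)"
      unfolding candidates_def set_map[symmetric] by simp
  qed
  ultimately have "search (candidates E vs w) [] (inc E w) u \<noteq> None"
    by (intro search_complete[OF card]) (use fin in auto)
  moreover have "w \<in> set vs" using w assms(1) by (auto simp: shattered_def)
  moreover have "inc E w \<noteq> {}" using sh[of "{}"] by auto
  ultimately show False using scan_None[OF none, of w] by simp
qed

section \<open>Weakest preconditions for the tree language\<close>

text \<open>Value and time are existentially quantified, so termination is part of what gets
  proved.\<close>

definition wp :: "program \<Rightarrow> tree list \<Rightarrow> expr \<Rightarrow> (tree \<Rightarrow> nat \<Rightarrow> bool) \<Rightarrow> bool" where
  "wp P xs e R \<longleftrightarrow> (\<exists>v t. eval P xs e v t \<and> R v t)"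

definition wps :: "program \<Rightarrow> tree list \<Rightarrow> expr list \<Rightarrow> (tree list \<Rightarrow> nat \<Rightarrow> bool) \<Rightarrow> bool" where
  "wps P xs es R \<longleftrightarrow> (\<exists>vs t. evals P xs es vs t \<and> R vs t)"

text \<open>Kept apart from \<open>wp\<close> so that simplification stops at function calls instead
  of unfolding recursive bodies for ever; at that point the specification of the callee is
  applied.\<close>

definition wpc :: "program \<Rightarrow> nat \<Rightarrow> tree list \<Rightarrow> (tree \<Rightarrow> nat \<Rightarrow> bool) \<Rightarrow> bool" where
  "wpc P i ys R \<longleftrightarrow> i < length P \<and> wp P ys (P ! i) R"

lemma wp_Arg [simp]: "wp P xs (Arg i) R \<longleftrightarrow> i < length xs \<and> R (xs ! i) 1"
  unfolding wp_def by (metis One_nat_def eval_ArgE eval_Arg)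

lemma wp_LeafE [simp]: "wp P xs LeafE R \<longleftrightarrow> R Leaf 1"
  unfolding wp_def by (metis One_nat_def eval_LeafE eval_Leaf)

lemma wp_NodeE [simp]:
  "wp P xs (NodeE a b) R \<longleftrightarrow> wp P xs a (\<lambda>u s. wp P xs b (\<lambda>v t. R (Node u v) (s + t + 1)))"
  unfolding wp_def by (metis Suc_eq_plus1 eval_NodeE eval_Node)

lemma wp_LeftE [simp]: "wp P xs (LeftE a) R \<longleftrightarrow> wp P xs a (\<lambda>v t. R (left v) (t + 1))"
  unfolding wp_def by (metis Suc_eq_plus1 eval_LeftE eval_Left)

lemma wp_RightE [simp]: "wp P xs (RightE a) R \<longleftrightarrow> wp P xs a (\<lambda>v t. R (right v) (t + 1))"
  unfolding wp_def by (metis Suc_eq_plus1 eval_RightE eval_Right)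

lemma wp_Cond [simp]:
  "wp P xs (Cond c a b) R \<longleftrightarrow>
     wp P xs c (\<lambda>w s. if w = Leaf then wp P xs b (\<lambda>v t. R v (s + t + 1))
                       else wp P xs a (\<lambda>v t. R v (s + t + 1)))"
  unfolding wp_def
proof (intro iffI; elim exE conjE)
  fix v t assume "eval P xs (Cond c a b) v t" "R v t"
  then show "\<exists>w s. eval P xs c w s \<and> (if w = Leaf then \<exists>v t. eval P xs b v t \<and> R v (s + t + 1)
                                   else \<exists>v t. eval P xs a v t \<and> R v (s + t + 1))"
    by (elim eval_CondE) (metis Suc_eq_plus1)+
next
  fix w s assume "eval P xs c w s" "if w = Leaf then \<exists>v t. eval P xs b v t \<and> R v (s + t + 1)
                                   else \<exists>v t. eval P xs a v t \<and> R v (s + t + 1)"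
  then show "\<exists>v t. eval P xs (Cond c a b) v t \<and> R v t"
    by (metis eval_Cond_true eval_Cond_false)
qed

lemma wp_Call [simp]:
  "wp P xs (Call i as) R \<longleftrightarrow> wps P xs as (\<lambda>ys s. wpc P i ys (\<lambda>v t. R v (s + t + 1)))"
  unfolding wp_def wps_def wpc_def by (metis Suc_eq_plus1 eval_CallE eval_Call)

lemma wps_Nil [simp]: "wps P xs [] R \<longleftrightarrow> R [] 0"
  unfolding wps_def by (auto elim: evals_NilE intro: eval_evals.intros)

lemma wps_Cons [simp]:
  "wps P xs (a # as) R \<longleftrightarrow> wp P xs a (\<lambda>v s. wps P xs as (\<lambda>vs t. R (v # vs) (s + t)))"
  unfolding wp_def wps_def by (fastforce elim!: evals_ConsE intro: eval_evals.intros)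

section \<open>The program\<close>

text \<open>The body of the function called by \<open>Call i\<close> is the \<open>i\<close>-th entry of \<open>prog\<close> below.\<close>

abbreviation "TrueE \<equiv> NodeE LeafE LeafE"

abbreviation "Eq a b \<equiv> Call 1 [a, b]"
abbreviation "Incr a \<equiv> Call 2 [a]"
abbreviation "Count u c a k \<equiv> Call 3 [u, c, a, k]"
abbreviation "Heads l \<equiv> Call 4 [l]"
abbreviation "Tails l \<equiv> Call 5 [l]"
abbreviation "Columns u l \<equiv> Call 6 [u, l]"
abbreviation "And m c \<equiv> Call 7 [m, c]"
abbreviation "Diff m c \<equiv> Call 8 [m, c]"
abbreviation "Any m \<equiv> Call 9 [m]"
abbreviation "Check s m \<equiv> Call 10 [s, m]"
abbreviation "Erase x l \<equiv> Call 11 [x, l]"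
abbreviation "Dedup l \<equiv> Call 12 [l]"
abbreviation "Restrict m l \<equiv> Call 13 [m, l]"
abbreviation "Combine r s \<equiv> Call 14 [r, s]"
abbreviation "Search l s m u \<equiv> Call 15 [l, s, m, u]"
abbreviation "First a b \<equiv> Call 16 [a, b]"
abbreviation "Loop w l u \<equiv> Call 17 [w, l, u]"
abbreviation "Start l c \<equiv> Call 18 [l, c]"

definition "main_body =
    Start (Columns (LeftE (Arg 0)) (LeftE (RightE (Arg 0))))
      (Count (LeftE (Arg 0)) (NodeE TrueE LeafE) LeafE (LeftE (RightE (RightE (Arg 0)))))"

definition "eq_body =
    Cond (Arg 0)
      (Cond (Arg 1)
        (Cond (Eq (LeftE (Arg 0)) (LeftE (Arg 1))) (Eq (RightE (Arg 0)) (RightE (Arg 1))) LeafE)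
        LeafE)
      (Cond (Arg 1) LeafE TrueE)"

definition "incr_body =
    Cond (Arg 0)
      (Cond (LeftE (Arg 0)) (NodeE LeafE (Incr (RightE (Arg 0)))) (NodeE TrueE (RightE (Arg 0))))
      (NodeE TrueE LeafE)"

text \<open>
  The result is \<open>k - c\<close> in unary, added to \<open>a\<close>. As \<open>k\<close> is not bounded in terms of the hypergraph,
  reading all of its digits may be too expensive; counting up from \<open>c\<close> and comparing never looks
  further into \<open>k\<close> than the counter is long.
\<close>

definition "count_body =
    Cond (Eq (Arg 1) (Arg 3)) (NodeE LeafE (Arg 2))
      (Cond (Arg 0) (Count (RightE (Arg 0)) (Incr (Arg 1)) (NodeE LeafE (Arg 2)) (Arg 3)) LeafE)"

definition "heads_body =
    Cond (Arg 0) (NodeE (LeftE (LeftE (Arg 0))) (Heads (RightE (Arg 0)))) LeafE"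

definition "tails_body =
    Cond (Arg 0) (NodeE (RightE (LeftE (Arg 0))) (Tails (RightE (Arg 0)))) LeafE"

definition "columns_body =
    Cond (Arg 0) (NodeE (Heads (Arg 1)) (Columns (RightE (Arg 0)) (Tails (Arg 1)))) LeafE"

definition "and_body =
    Cond (Arg 0)
      (NodeE (Cond (LeftE (Arg 0)) (LeftE (Arg 1)) LeafE) (And (RightE (Arg 0)) (RightE (Arg 1))))
      LeafE"

definition "diff_body =
    Cond (Arg 0)
      (NodeE (Cond (LeftE (Arg 1)) LeafE (LeftE (Arg 0))) (Diff (RightE (Arg 0)) (RightE (Arg 1))))
      LeafE"

definition "any_body =
    Cond (Arg 0) (Cond (LeftE (Arg 0)) TrueE (Any (RightE (Arg 0)))) LeafE"

definition "check_body =
    Cond (Arg 0)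
      (Cond (Check (RightE (Arg 0)) (And (Arg 1) (LeftE (Arg 0))))
        (Check (RightE (Arg 0)) (Diff (Arg 1) (LeftE (Arg 0)))) LeafE)
      (Any (Arg 1))"

definition "erase_body =
    Cond (Arg 1)
      (NodeE (Cond (Eq (Arg 0) (LeftE (Arg 1))) LeafE (LeftE (Arg 1)))
        (Erase (Arg 0) (RightE (Arg 1))))
      LeafE"

definition "dedup_body =
    Cond (Arg 0) (NodeE (LeftE (Arg 0)) (Dedup (Erase (LeftE (Arg 0)) (RightE (Arg 0))))) LeafE"

definition "restrict_body =
    Cond (Arg 1) (NodeE (And (Arg 0) (LeftE (Arg 1))) (Restrict (Arg 0) (RightE (Arg 1)))) LeafE"

definition "combine_body =
    Cond (Arg 0) (NodeE LeafE (NodeE TrueE (RightE (Arg 0))))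
      (Cond (Arg 1) (NodeE LeafE (NodeE LeafE (RightE (Arg 1)))) LeafE)"

definition "search_body =
    Cond (Arg 0)
      (Combine
        (Cond (LeftE (Arg 0))
          (Cond (Arg 3)
            (Cond (Check (NodeE (LeftE (Arg 0)) (Arg 1)) (Arg 2))
              (Search (RightE (Arg 0)) (NodeE (LeftE (Arg 0)) (Arg 1)) (Arg 2) (RightE (Arg 3)))
              LeafE)
            LeafE)
          LeafE)
        (Search (RightE (Arg 0)) (Arg 1) (Arg 2) (Arg 3)))
      (Cond (Arg 3) LeafE TrueE)"

definition "first_body =
    Cond (Arg 0) (Arg 0) (Arg 1)"

definition "loop_body =
    Cond (Arg 0)
      (First
        (Cond (Any (LeftE (Arg 0)))
          (Search (Dedup (Restrict (LeftE (Arg 0)) (Arg 1))) LeafE (LeftE (Arg 0)) (Arg 2)) LeafE)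
        (Loop (RightE (Arg 0)) (Arg 1) (Arg 2)))
      LeafE"

definition "start_body =
    Cond (Arg 1) (Loop (Arg 0) (Arg 0) (RightE (Arg 1))) LeafE"

definition prog :: program where
  "prog = [main_body, eq_body, incr_body, count_body, heads_body, tails_body, columns_body,
     and_body, diff_body, any_body, check_body, erase_body, dedup_body, restrict_body,
     combine_body, search_body, first_body, loop_body, start_body]"

lemma length_prog [simp]: "length prog = 19"
  by (simp add: prog_def)

lemma prog_nth [simp]:
  "prog ! 0 = main_body"
  "prog ! Suc 0 = eq_body"
  "prog ! 2 = incr_body"
  "prog ! 3 = count_body"
  "prog ! 4 = heads_body"
  "prog ! 5 = tails_body"
  "prog ! 6 = columns_body"
  "prog ! 7 = and_body"
  "prog ! 8 = diff_body"
  "prog ! 9 = any_body"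
  "prog ! 10 = check_body"
  "prog ! 11 = erase_body"
  "prog ! 12 = dedup_body"
  "prog ! 13 = restrict_body"
  "prog ! 14 = combine_body"
  "prog ! 15 = search_body"
  "prog ! 16 = first_body"
  "prog ! 17 = loop_body"
  "prog ! 18 = start_body"
  by (simp_all add: prog_def)

section \<open>Running times of the functions\<close>

definition computes :: "nat \<Rightarrow> tree list \<Rightarrow> tree \<Rightarrow> nat \<Rightarrow> bool" where
  "computes i ys v T \<longleftrightarrow> wpc prog i ys (\<lambda>w t. w = v \<and> t \<le> T)"

lemma wpcI: "computes i ys v T \<Longrightarrow> (\<And>t. t \<le> T \<Longrightarrow> R v t) \<Longrightarrow> wpc prog i ys R"
  unfolding computes_def wpc_def wp_def by blast

lemma computesI:
  "i < length prog \<Longrightarrow> wp prog ys (prog ! i) (\<lambda>w t. w = v \<and> t \<le> T) \<Longrightarrow> computes i ys v T"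
  unfolding computes_def wpc_def by blast

lemma computes_mono: "computes i ys v T \<Longrightarrow> T \<le> T' \<Longrightarrow> computes i ys v T'"
  unfolding computes_def wpc_def wp_def by (meson le_trans)

lemma enc_bool_eq_Leaf [simp]: "enc_bool b = Leaf \<longleftrightarrow> \<not> b"
  by (simp add: enc_bool_def)

lemma enc_list_eq_Leaf [simp]: "enc_list xs = Leaf \<longleftrightarrow> xs = []"
  by (cases xs) auto

lemma enc_bool_simps [simp]: "enc_bool True = Node Leaf Leaf" "enc_bool False = Leaf"
  by (simp_all add: enc_bool_def)

text \<open>Both trees are traversed in lockstep and no deeper than either reaches, so the first
  argument alone bounds the time. The second may then be the numeral of an arbitrarily large
  k.\<close>

lemma computes_Eq: "computes (Suc 0) [a, b] (enc_bool (a = b)) (50 * (2 * size a + 1))"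
proof (induction a arbitrary: b)
  case Leaf
  show ?case by (rule computesI) (auto simp: eq_body_def)
next
  case (Node l r)
  show ?case
  proof (cases b)
    case Leaf
    then show ?thesis by (intro computesI) (auto simp: eq_body_def)
  next
    case (Node l' r')
    show ?thesis
      apply (rule computesI)
       apply simp
      apply (simp add: eq_body_def Node)
      apply (rule wpcI[OF Node.IH(1)])
      apply (auto intro!: wpcI[OF Node.IH(2)])
      done
  qed
qed

lemma enc_set_Nil [simp]: "enc_set [] A = Leaf"
  by (simp add: enc_set_def)

lemma enc_set_Cons [simp]: "enc_set (e # es) A = Node (enc_bool (e \<in> A)) (enc_set es A)"
  by (simp add: enc_set_def)

lemma enc_set_eq_Leaf [simp]: "enc_set es A = Leaf \<longleftrightarrow> es = []"
  by (cases es) auto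

lemma enc_set_cong: "(\<And>e. e \<in> set es \<Longrightarrow> e \<in> A \<longleftrightarrow> e \<in> B) \<Longrightarrow> enc_set es A = enc_set es B"
  by (induction es) auto

lemma enc_bool_inject [simp]: "enc_bool a = enc_bool b \<longleftrightarrow> a = b"
  by (simp add: enc_bool_def)

lemma enc_set_eqD: "enc_set es A = enc_set es B \<Longrightarrow> e \<in> set es \<Longrightarrow> e \<in> A \<longleftrightarrow> e \<in> B"
  by (induction es) auto

lemma size_enc_bool: "size (enc_bool b) \<le> 1"
  by (cases b) auto

lemma size_enc_set: "size (enc_set es A) \<le> 2 * length es"
proof (induction es)
  case (Cons e es)
  then show ?case using size_enc_bool[of "e \<in> A"] by simp
qed simp

section \<open>Binary numbers and the bounded counter\<close>

lemma enc_nat_0 [simp]: "enc_nat 0 = Leaf"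
  by (simp add: enc_nat_def bits.simps[of 0])

lemma enc_nat_pos: "n > 0 \<Longrightarrow> enc_nat n = Node (enc_bool (odd n)) (enc_nat (n div 2))"
  by (simp add: enc_nat_def bits.simps[of n])

lemma enc_nat_inject: "enc_nat m = enc_nat n \<longleftrightarrow> m = n"
proof
  show "enc_nat m = enc_nat n \<Longrightarrow> m = n"
  proof (induction m arbitrary: n rule: less_induct)
    case (less m)
    show ?case
    proof (cases "m = 0 \<or> n = 0")
      case True
      then show ?thesis using less.prems by (cases "m = 0"; cases "n = 0") (auto simp: enc_nat_pos)
    next
      case False
      then have "odd m = odd n" "enc_nat (m div 2) = enc_nat (n div 2)"
        using less.prems by (auto simp: enc_nat_pos)
      moreover then have "m div 2 = n div 2" using less.IH[of "m div 2"] False by simp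
      ultimately show ?thesis by presburger
    qed
  qed
qed simp

text \<open>A linear bound instead of a logarithmic one is good enough, because the counter never
  exceeds the number of vertices plus 1.\<close>

lemma size_enc_nat: "size (enc_nat n) \<le> 2 * n"
proof (induction n rule: less_induct)
  case (less n)
  show ?case
  proof (cases "n = 0")
    case False
    then have "size (enc_nat (n div 2)) \<le> 2 * (n div 2)" using less by simp
    then show ?thesis using False size_enc_bool[of "odd n"] by (simp add: enc_nat_pos) presburger
  qed simp
qed

lemma computes_Incr: "computes 2 [enc_nat n] (enc_nat (n + 1)) (50 * (n + 1))"
proof (induction n rule: less_induct)
  case (less n)
  show ?case
  proof (cases "n = 0")
    case True
    then show ?thesis
      by (intro computesI) (auto simp: incr_body_def enc_nat_pos)
  next
    case False
    then have IH: "computes 2 [enc_nat (n div 2)] (enc_nat (n div 2 + 1)) (50 * (n div 2 + 1))"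
      by (intro less) auto
    show ?thesis
    proof (cases "odd n")
      case True
      then have "(n + 1) div 2 = n div 2 + 1" by presburger
      moreover have "n div 2 + 1 \<le> n" using False by presburger
      ultimately show ?thesis
        using True False
        by (intro computesI) (auto simp: incr_body_def enc_nat_pos intro!: wpcI[OF IH])
    next
      case False
      then have "(n + 1) div 2 = n div 2" by presburger
      then show ?thesis
        using False \<open>n \<noteq> 0\<close> by (intro computesI) (auto simp: incr_body_def enc_nat_pos)
    qed
  qed
qed

abbreviation unary :: "nat \<Rightarrow> tree" where
  "unary n \<equiv> enc_list (replicate n Leaf)"

text \<open>The bound does not mention k: the unary n is fuel, and each unit pays for one comparison
  and one increment. The extra \<open>Node Leaf\<close> around the result separates the unary 0,
  which is \<open>Leaf\<close>, from running out of fuel.\<close>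

lemma computes_Count:
  "computes 3 [unary n, enc_nat c, unary a, enc_nat k]
     (if c \<le> k \<and> k \<le> c + n then Node Leaf (unary (a + (k - c))) else Leaf)
     (500 * (n + 1) * (c + n + 1))"
proof (induction n arbitrary: c a)
  case 0
  have "50 * (2 * size (enc_nat c) + 1) \<le> 200 * c + 50" using size_enc_nat[of c] by simp
  then show ?case
    by (intro computesI) (auto simp: count_body_def enc_nat_inject intro!: wpcI[OF computes_Eq])
next
  case (Suc n)
  have eq: "50 * (2 * size (enc_nat c) + 1) \<le> 200 * c + 50" using size_enc_nat[of c] by simp
  have eq': "50 * (2 * size (enc_nat c) + 1) + 50 * (c + 1) + 500 * (n + 1) * (c + 1 + n + 1) + 100 \<le>
      500 * (Suc n + 1) * (c + Suc n + 1)"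
    using eq by (simp add: algebra_simps)
  show ?case
  proof (cases "c = k")
    case True
    then show ?thesis using eq'
      by (intro computesI) (auto simp: count_body_def intro!: wpcI[OF computes_Eq])
  next
    case False
    define r where
      "r = (if c \<le> k \<and> k \<le> c + Suc n then Node Leaf (unary (a + (k - c))) else Leaf)"
    have "(if c + 1 \<le> k \<and> k \<le> c + 1 + n then Node Leaf (unary (Suc a + (k - (c + 1)))) else Leaf) = r"
    proof (cases "c + 1 \<le> k")
      case True
      then have "Suc a + (k - (c + 1)) = a + (k - c)" by simp
      with True show ?thesis by (simp add: r_def)
    qed (use False in \<open>auto simp: r_def\<close>)
    with Suc.IH[of "c + 1" "Suc a"]
    have IH: "computes 3 [unary n, enc_nat (c + 1), Node Leaf (unary a), enc_nat k] r
        (500 * (n + 1) * (c + 1 + n + 1))"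
      by (simp only: replicate_Suc enc_list.simps)
    show ?thesis using False eq' unfolding r_def[symmetric]
      apply (intro computesI)
       apply simp
      apply (simp add: count_body_def)
      apply (rule wpcI[OF computes_Eq])
      apply (simp add: enc_nat_inject)
      apply (rule wpcI[OF computes_Incr])
      apply simp
      apply (rule wpcI[OF IH[simplified]])
      apply simp
      done
  qed
qed

section \<open>The incidence matrix and operations on its columns\<close>

lemma computes_Heads: "computes 4 [enc_list xs] (enc_list (map left xs)) (30 * (length xs + 1))"
proof (induction xs)
  case Nil
  show ?case by (intro computesI) (auto simp: heads_body_def)
next
  case (Cons x xs)
  show ?case by (intro computesI) (auto simp: heads_body_def intro!: wpcI[OF Cons.IH])
qed

lemma computes_Tails: "computes 5 [enc_list xs] (enc_list (map right xs)) (30 * (length xs + 1))"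
proof (induction xs)
  case Nil
  show ?case by (intro computesI) (auto simp: tails_body_def)
next
  case (Cons x xs)
  show ?case by (intro computesI) (auto simp: tails_body_def intro!: wpcI[OF Cons.IH])
qed

text \<open>A transposition: the input has one row per hyperedge, the search needs one column per
  vertex. The recursion runs over the unary vertex count, since without hyperedges there is no row
  to tell the number of columns.\<close>

lemma computes_Columns:
  "computes 6 [enc_list (map (\<lambda>_. Leaf) vs), enc_list (map (enc_set vs) es)]
     (enc_list (map (\<lambda>v. enc_set es (inc (set es) v)) vs))
     (100 * (length vs + 1) * (length es + 1))"
proof (induction vs)
  case Nil
  show ?case by (intro computesI) (auto simp: columns_body_def)
next
  case (Cons v vs)
  let ?rows = "map (enc_set (v # vs)) es"
  have heads: "computes 4 [enc_list ?rows] (enc_set es (inc (set es) v)) (30 * (length es + 1))"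
    using computes_Heads[of ?rows] by (simp add: enc_set_def inc_def comp_def cong: map_cong)
  have tails: "computes 5 [enc_list ?rows] (enc_list (map (enc_set vs) es)) (30 * (length es + 1))"
    using computes_Tails[of ?rows] by (simp add: comp_def)
  show ?case
    apply (intro computesI)
     apply simp
    apply (simp add: columns_body_def del: enc_set_Cons)
    apply (rule wpcI[OF heads])
    apply (rule wpcI[OF tails])
    apply (rule wpcI[OF Cons.IH])
    apply (simp add: algebra_simps)
    done
qed

lemma computes_And:
  "computes 7 [enc_set es A, enc_set es B] (enc_set es (A \<inter> B)) (50 * (length es + 1))"
proof (induction es)
  case Nil
  show ?case by (intro computesI) (auto simp: and_body_def)
next
  case (Cons e es)
  show ?case by (intro computesI) (auto simp: and_body_def intro!: wpcI[OF Cons.IH])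
qed

lemma computes_Diff:
  "computes 8 [enc_set es A, enc_set es B] (enc_set es (A - B)) (50 * (length es + 1))"
proof (induction es)
  case Nil
  show ?case by (intro computesI) (auto simp: diff_body_def)
next
  case (Cons e es)
  show ?case by (intro computesI) (auto simp: diff_body_def intro!: wpcI[OF Cons.IH])
qed

lemma computes_Any:
  "computes 9 [enc_set es A] (enc_bool (A \<inter> set es \<noteq> {})) (50 * (length es + 1))"
proof (induction es)
  case Nil
  show ?case by (intro computesI) (auto simp: any_body_def)
next
  case (Cons e es)
  show ?case by (intro computesI) (auto simp: any_body_def intro!: wpcI[OF Cons.IH])
qed

text \<open>Since only the bits at \<open>es\<close> are tested for being nonempty, m must not have
  points elsewhere. The base 4 is generous: two recursive calls suggest 2, but its square is still
  polynomial in the number of hyperedges when the tested family is logarithmically small.\<close>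

lemma computes_Check:
  "m \<subseteq> set es \<Longrightarrow> computes 10 [enc_list (map (enc_set es) cs), enc_set es m]
     (enc_bool (splits cs m)) (200 * (length es + 1) * 4 ^ length cs)"
proof (induction cs arbitrary: m)
  case Nil
  then have "m \<inter> set es = m" by auto
  with Nil show ?case
    by (intro computesI) (auto simp: check_body_def intro!: wpcI[OF computes_Any])
next
  case (Cons c cs)
  define X where "X = 200 * (length es + 1) * 4 ^ length cs"
  define Y where "Y = 200 * (length es + 1) * 4 ^ length (c # cs)"
  have IH1: "computes 10 [enc_list (map (enc_set es) cs), enc_set es (m \<inter> c)]
     (enc_bool (splits cs (m \<inter> c))) X"
    unfolding X_def by (rule Cons.IH) (use Cons.prems in auto)
  have IH2: "computes 10 [enc_list (map (enc_set es) cs), enc_set es (m - c)]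
     (enc_bool (splits cs (m - c))) X"
    unfolding X_def by (rule Cons.IH) (use Cons.prems in auto)
  \<comment> \<open>With base 4 the budget is 4 X. The two recursive calls take 2 X, and the other 2
    X cover the linear work of forming both halves.\<close>
  have "200 * (length es + 1) * 1 \<le> X" unfolding X_def by (intro mult_le_mono) auto
  moreover have "Y = 4 * X" by (simp add: X_def Y_def)
  ultimately have Y: "2 * X + 100 * length es + 200 \<le> Y" by simp
  show ?case unfolding Y_def[symmetric]
    apply (intro computesI)
     apply simp
    apply (simp add: check_body_def)
    apply (rule wpcI[OF computes_And])
    apply (rule wpcI[OF IH1])
    apply simp
    apply (intro conjI impI)
    subgoal using Y by simp
    apply (rule wpcI[OF computes_Diff])
    apply (rule wpcI[OF IH2])
    subgoal using Y by simp
    done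
qed

lemma computes_Erase:
  "computes 11 [x, enc_list ys] (enc_list (map (\<lambda>y. if x = y then Leaf else y) ys))
     (150 * (2 * size x + 1) * (length ys + 1))"
proof (induction ys)
  case Nil
  show ?case by (intro computesI) (auto simp: erase_body_def)
next
  case (Cons y ys)
  show ?case
  proof (cases "x = y")
    case True
    show ?thesis
      apply (intro computesI)
       apply simp
      apply (simp add: erase_body_def True)
      apply (rule wpcI[OF computes_Eq])
      apply simp
      apply (rule wpcI[OF Cons.IH[unfolded True]])
      apply simp
      done
  next
    case False
    then show ?thesis
      apply (intro computesI)
       apply simp
      apply (simp add: erase_body_def)
      apply (rule wpcI[OF computes_Eq])
      apply simp
      apply (rule wpcI[OF Cons.IH])
      apply simp
      done
  qed
qed

text \<open>Erasing turns entries into \<open>Leaf\<close>, of size 0, so the size bound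
  \<open>Z\<close> survives the recursion.\<close>

lemma computes_Dedup:
  "\<forall>x\<in>set xs. size x \<le> Z \<Longrightarrow>
    computes 12 [enc_list xs] (enc_list (dedup Leaf xs)) (200 * (2 * Z + 1) * (length xs + 1)\<^sup>2)"
proof (induction "Leaf" xs rule: dedup.induct)
  case 1
  show ?case by (intro computesI) (auto simp: dedup_body_def)
next
  case (2 x xs)
  let ?ys = "map (\<lambda>y. if x = y then Leaf else y) xs"
  have IH: "computes 12 [enc_list ?ys] (enc_list (dedup Leaf ?ys))
      (200 * (2 * Z + 1) * (length ?ys + 1)\<^sup>2)"
    by (rule "2.hyps") (use "2.prems" in auto)
  have "150 * (2 * size x + 1) * (length xs + 1) \<le> 150 * (2 * Z + 1) * (length xs + 1)"
    using 2 by (intro mult_le_mono) auto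
  then have T: "150 * (2 * size x + 1) * (length xs + 1) + 200 * (2 * Z + 1) * (length xs + 1)\<^sup>2 + 50
      \<le> 200 * (2 * Z + 1) * (length (x # xs) + 1)\<^sup>2"
    by (simp add: algebra_simps power2_eq_square)
  show ?case
    apply (intro computesI)
     apply simp
    apply (simp add: dedup_body_def)
    apply (rule wpcI[OF computes_Erase])
    apply (rule wpcI[OF IH])
    using T apply simp
    done
qed

lemma computes_Restrict:
  "computes 13 [enc_set es m, enc_list (map (\<lambda>v. enc_set es (g v)) vs)]
     (enc_list (map (\<lambda>v. enc_set es (m \<inter> g v)) vs)) (100 * (length es + 1) * (length vs + 1))"
proof (induction vs)
  case Nil
  show ?case by (intro computesI) (auto simp: restrict_body_def)
next
  case (Cons v vs)
  show ?case
    apply (intro computesI)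
     apply simp
    apply (simp add: restrict_body_def)
    apply (rule wpcI[OF computes_And])
    apply (rule wpcI[OF Cons.IH])
    apply simp
    done
qed

section \<open>Cost of the search\<close>

lemma enc_answer_eq_Leaf [simp]: "enc_answer vs r = Leaf \<longleftrightarrow> r = None"
  by (cases r) auto

text \<open>Both answers are characteristic vectors over the vertices after v, so the bit of v is
  put in front: true for the branch that took v, false for the other one. The assumption on s makes
  the false bit correct.\<close>

lemma computes_Combine:
  assumes "v \<notin> set vs" "\<And>W. s = Some W \<Longrightarrow> v \<notin> W"
  shows "computes 14 [enc_answer vs r, enc_answer vs s]
     (enc_answer (v # vs) (case r of Some W \<Rightarrow> Some (insert v W) | None \<Rightarrow> s)) 50"
proof -
  have "enc_set vs (insert v W) = enc_set vs W" for W
    using assms(1) by (intro enc_set_cong) auto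
  then show ?thesis using assms(2)
    by (intro computesI) (auto simp: combine_body_def split: option.splits)
qed

lemma computes_First: "computes 16 [a, b] (if a = Leaf then b else a) 10"
  by (intro computesI) (auto simp: first_body_def)

text \<open>An erased entry is the tree that the program tests as false. It differs from every
  encoded trace as long as there is a hyperedge, because even the empty set is then a nonempty list
  of bits.\<close>

fun enc_candidate :: "'e list \<Rightarrow> 'e set option \<Rightarrow> tree" where
  "enc_candidate es None = Leaf"
| "enc_candidate es (Some c) = enc_set es c"

lemma search_subset: "search ps cs m u = Some W \<Longrightarrow> W \<subseteq> fst ` set ps"
proof (induction ps arbitrary: cs u W)
  case Nil
  then show ?case by (auto split: if_splits)
next
  case (Cons p ps)
  obtain v x where p: "p = (v, x)" by fastforce
  consider W' cs' u' where "search ps cs' m u' = Some W'" "W = insert v W'"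
    | "search ps cs m u = Some W"
    using Cons.prems unfolding p by (auto split: option.splits if_splits)
  then show ?case
  proof cases
    case 1
    then show ?thesis using Cons.IH[OF 1(1)] p by auto
  next
    case 2
    then show ?thesis using Cons.IH[OF 2] by auto
  qed
qed

text \<open>The recurrence of the search at an entry with a trace: b is local work, taking the entry
  leaves depth d, skipping it leaves depth d + 1, each with D traces. The powers add up to
  \<open>(D + 2) * (D + 1) ^ d\<close>, which is at most \<open>(D + 2) ^ Suc d\<close>; the step
  from L + 1 to L + 2 pays for b.\<close>

lemma branching_bound:
  fixes B b L D d :: nat
  assumes "b \<le> B"
  shows "b + B * (L + 1) * (D + 1) ^ d + B * (L + 1) * (D + 1) ^ Suc d \<le> B * (L + 2) * (D + 2) ^ Suc d"
proof -
  have "(D + 1) ^ d \<le> (D + 2) ^ d" by (intro power_mono) auto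
  then have "(D + 2) * (D + 1) ^ d \<le> (D + 2) * (D + 2) ^ d" by (intro mult_le_mono) auto
  then have *: "(D + 1) ^ d + (D + 1) ^ Suc d \<le> (D + 2) ^ Suc d" by (simp add: algebra_simps)
  have "b + B * (L + 1) * (D + 1) ^ d + B * (L + 1) * (D + 1) ^ Suc d =
      b + B * (L + 1) * ((D + 1) ^ d + (D + 1) ^ Suc d)" by (simp add: algebra_simps)
  also have "\<dots> \<le> B * (D + 2) ^ Suc d + B * (L + 1) * (D + 2) ^ Suc d"
  proof (intro add_mono mult_le_mono order_refl *)
    have "B * 1 \<le> B * (D + 2) ^ Suc d" by (intro mult_le_mono one_le_power) auto
    with assms show "b \<le> B * (D + 2) ^ Suc d" by (simp only: mult_1_right)
  qed
  also have "\<dots> = B * (L + 2) * (D + 2) ^ Suc d" by (simp add: algebra_simps)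
  finally show ?thesis .
qed

text \<open>
  The exponent \<open>d\<close> bounds the remaining depth: adding a trace while \<open>splits\<close> holds doubles
  \<open>2 ^ length cs \<le> card m\<close>.
\<close>

lemma computes_Search:
  assumes "m \<subseteq> set es" "es \<noteq> []" "distinct (map fst ps)"
    and "splits cs m" "card m < 2 ^ (length cs + d)"
  shows "computes 15 [enc_list (map (\<lambda>p. enc_candidate es (snd p)) ps),
        enc_list (map (enc_set es) cs), enc_set es m, unary u]
      (enc_answer (map fst ps) (search ps cs m u))
      (1000 * (length es + 1) ^ 3 * (length ps + 1) *
        (length (filter (\<lambda>p. snd p \<noteq> None) ps) + 1) ^ d)"
  using assms(3-5)
proof (induction ps arbitrary: cs u d)
  case Nil
  define B where "B = 1000 * (length es + 1) ^ 3"
  have "1000 * 1 \<le> B" unfolding B_def by (intro mult_le_mono) auto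
  then show ?case unfolding B_def[symmetric] by (intro computesI) (auto simp: search_body_def)
next
  case (Cons p ps)
  obtain v x where p: "p = (v, x)" by fastforce
  define B where "B = 1000 * (length es + 1) ^ 3"
  define D where "D = length (filter (\<lambda>p. snd p \<noteq> None) ps)"
  define L where "L = length ps"
  \<comment> \<open>Only the length counts here: \<open>x # map Some cs\<close> is as long as
    \<open>c # cs\<close>, but can be written before x is known to be a trace.\<close>
  define C where "C = 200 * (length es + 1) * 4 ^ length (x # map Some cs)"
  have finm: "finite m" using assms(1) by (rule finite_subset) simp
  have dist: "distinct (map fst ps)" and v: "v \<notin> set (map fst ps)" using Cons.prems(1) p by auto
  have "card m \<le> card (set es)" using assms(1) by (intro card_mono) auto
  then have cardm: "card m \<le> length es" using card_length[of es] by linarith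
  have pow: "2 ^ length cs \<le> length es"
    using splits_card[OF Cons.prems(2) finm] cardm by linarith
  \<comment> \<open>\<open>4 ^ length cs\<close> is the square of \<open>2 ^ length cs\<close>,
    hence at most quadratic in the number of hyperedges. Together with the linear factor of a test
    this gives the exponent 3 in B.\<close>
  have C: "C + 100 \<le> B"
  proof -
    have "(4::nat) ^ length cs = (2 ^ length cs)\<^sup>2"
      by (simp add: power2_eq_square power_mult_distrib[symmetric])
    also have "\<dots> \<le> (length es + 1)\<^sup>2" using pow by (intro power_mono) auto
    finally have "800 * (length es + 1) * 4 ^ length cs \<le> 800 * (length es + 1) * (length es + 1)\<^sup>2"
      by (intro mult_le_mono order_refl)
    moreover have "C = 800 * (length es + 1) * 4 ^ length cs" by (simp add: C_def)
    ultimately have "C \<le> 800 * (length es + 1) * (length es + 1)\<^sup>2" by (simp only:)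
    also have "\<dots> = 800 * (length es + 1) ^ 3" by (simp add: power2_eq_square power3_eq_cube algebra_simps)
    finally have "C \<le> 800 * (length es + 1) ^ 3" .
    moreover have "1 \<le> (length es + 1) ^ 3" by simp
    ultimately show ?thesis unfolding B_def by linarith
  qed
  define F where "F = (\<lambda>d. B * (L + 1) * (D + 1) ^ d)"
  have IH: "computes 15 [enc_list (map (\<lambda>p. enc_candidate es (snd p)) ps),
        enc_list (map (enc_set es) cs'), enc_set es m, unary u']
      (enc_answer (map fst ps) (search ps cs' m u')) (F d')"
    if "splits cs' m" "card m < 2 ^ (length cs' + d')" for cs' u' d'
    using Cons.IH[OF dist that] by (simp only: F_def B_def D_def L_def)
  define r where "r = (case x of None \<Rightarrow> None
      | Some c \<Rightarrow> if u \<noteq> 0 \<and> splits (c # cs) m then search ps (c # cs) m (u - 1) else None)"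
  define s where "s = search ps cs m u"
  define a where "a = enc_answer (v # map fst ps) (case r of Some W \<Rightarrow> Some (insert v W) | None \<Rightarrow> s)"
  have comb: "computes 14 [enc_answer (map fst ps) r, enc_answer (map fst ps) s] a 50"
    unfolding a_def
  proof (rule computes_Combine[OF v])
    fix W assume "s = Some W"
    then show "v \<notin> W" using search_subset[of ps cs m u W] v by (auto simp: s_def)
  qed
  have a: "enc_answer (map fst (p # ps)) (search (p # ps) cs m u) = a"
    unfolding a_def p r_def s_def by simp
  have skip: "computes 15 [enc_list (map (\<lambda>p. enc_candidate es (snd p)) ps),
        enc_list (map (enc_set es) cs), enc_set es m, unary u]
      (enc_answer (map fst ps) s) (F d)"
    unfolding s_def by (rule IH) (use Cons.prems in auto)
  define G where "G = B * (L + 2) * (length (filter (\<lambda>p. snd p \<noteq> None) (p # ps)) + 1) ^ d"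
  \<comment> \<open>If only the skipping branch is taken, one more list entry raises the budget by
    at least B, which covers the test and the local steps.\<close>
  have FG: "F d + C + 100 \<le> G"
  proof -
    let ?D = "length (filter (\<lambda>p. snd p \<noteq> None) (p # ps))"
    have 1: "1 \<le> (?D + 1) ^ d" by simp
    have "(D + 1) ^ d \<le> (?D + 1) ^ d" unfolding D_def by (intro power_mono) auto
    then have "F d \<le> B * (L + 1) * (?D + 1) ^ d" unfolding F_def by (intro mult_le_mono) auto
    moreover have "B * 1 \<le> B * (?D + 1) ^ d" using 1 by (intro mult_le_mono) auto
    moreover have "G = B * (L + 1) * (?D + 1) ^ d + B * (?D + 1) ^ d"
      unfolding G_def by (simp add: algebra_simps)
    ultimately show ?thesis using C by linarith
  qed
  have "computes 15 [enc_list (map (\<lambda>p. enc_candidate es (snd p)) (p # ps)),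
      enc_list (map (enc_set es) cs), enc_set es m, unary u] a G"
  proof (cases "\<exists>c. x = Some c \<and> u \<noteq> 0")
    case False
    then have r: "r = None" by (auto simp: r_def split: option.splits)
    have comb': "computes 14 [Leaf, enc_answer (map fst ps) s] a 50"
      using comb by (simp add: r)
    show ?thesis
    proof (cases x)
      case None
      show ?thesis
        apply (intro computesI)
         apply simp
        apply (simp add: search_body_def p None)
        apply (rule wpcI[OF skip])
        apply (rule wpcI[OF comb'])
        using FG apply simp
        done
    next
      case (Some c)
      with False have u: "u = 0" by simp
      show ?thesis
        apply (intro computesI)
         apply simp
        apply (simp add: search_body_def p Some assms(2) u)
        apply (rule wpcI[OF skip[unfolded u, simplified]])
        apply (rule wpcI[OF comb'])
        using FG apply simp
        done
    qed
  next
    case True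
    then obtain c u' where c: "x = Some c" "u = Suc u'" by (metis not0_implies_Suc)
    have check: "computes 10 [Node (enc_set es c) (enc_list (map (enc_set es) cs)), enc_set es m]
        (enc_bool (splits (c # cs) m)) C"
      using computes_Check[OF assms(1), of "c # cs"] unfolding C_def by simp
    have skip': "computes 15 [enc_list (map (\<lambda>p. enc_candidate es (snd p)) ps),
        enc_list (map (enc_set es) cs), enc_set es m, Node Leaf (unary u')]
      (enc_answer (map fst ps) s) (F d)"
      using skip by (simp add: c)
    show ?thesis
    proof (cases "splits (c # cs) m")
      case False
      then have r: "r = None" by (auto simp: r_def c)
      have comb': "computes 14 [Leaf, enc_answer (map fst ps) s] a 50"
        using comb by (simp add: r)
      show ?thesis
        apply (intro computesI)
         apply simp
        apply (simp add: search_body_def p c assms(2))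
        apply (rule wpcI[OF check])
        apply (simp only: False enc_bool_simps)
        apply simp
        apply (rule wpcI[OF skip'])
        apply (rule wpcI[OF comb'])
        using FG apply simp
        done
    next
      case sp: True
      \<comment> \<open>A successful test for \<open>c # cs\<close> needs twice as many points as
        \<open>cs\<close> does, so the depth bound d cannot be 0 and may drop by one for the branch
        that takes c.\<close>
      have "(2::nat) ^ (length cs + 1) < 2 ^ (length cs + d)"
        using splits_card[OF sp finm] Cons.prems(3) by simp
      then have "length cs + 1 < length cs + d" by (rule power_less_imp_less_exp[rotated]) simp
      then obtain d' where d': "d = Suc d'" by (cases d) auto
      have r: "r = search ps (c # cs) m u'" using sp by (simp add: r_def c)
      have "computes 15 [enc_list (map (\<lambda>p. enc_candidate es (snd p)) ps),
          enc_list (map (enc_set es) (c # cs)), enc_set es m, unary u']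
          (enc_answer (map fst ps) r) (F d')"
        unfolding r by (rule IH) (use Cons.prems(3) sp d' in auto)
      then have incl: "computes 15 [enc_list (map (\<lambda>p. enc_candidate es (snd p)) ps),
          Node (enc_set es c) (enc_list (map (enc_set es) cs)), enc_set es m, unary u']
          (enc_answer (map fst ps) r) (F d')"
        by simp
      have "C + 100 + F d' + F (Suc d') \<le> B * (L + 2) * (D + 2) ^ Suc d'"
        unfolding F_def by (rule branching_bound[OF C])
      also have "\<dots> = G" by (simp add: G_def D_def p c d')
      finally have G: "C + 100 + F d' + F d \<le> G" by (simp only: d')
      show ?thesis
        apply (intro computesI)
         apply simp
        apply (simp add: search_body_def p c assms(2))
        apply (rule wpcI[OF check])
        apply (simp only: sp enc_bool_simps)
        apply simp
        apply (rule wpcI[OF incl])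
        apply (rule wpcI[OF skip'])
        apply (rule wpcI[OF comb])
        using G apply simp
        done
    qed
  qed
  then show ?case unfolding a by (simp add: G_def B_def L_def)
qed

lemma inj_on_enc_candidate:
  assumes "es \<noteq> []" "\<And>c. Some c \<in> A \<Longrightarrow> c \<subseteq> set es"
  shows "inj_on (enc_candidate es) A"
proof (rule inj_onI)
  fix x y assume xy: "x \<in> A" "y \<in> A" "enc_candidate es x = enc_candidate es y"
  show "x = y"
  proof (cases "x = None \<or> y = None")
    case True
    then show ?thesis using xy(3) assms(1) by (cases x; cases y) (auto simp: eq_commute[of Leaf])
  next
    case False
    then obtain c d where cd: "x = Some c" "y = Some d" by auto
    then have "c \<subseteq> set es" "d \<subseteq> set es" using xy assms(2) by auto
    then have "c = d" using xy(3) cd enc_set_eqD[of es c d] by auto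
    then show ?thesis using cd by simp
  qed
qed

lemma inc_subset: "inc E v \<subseteq> E"
  by (auto simp: inc_def)

lemma computes_Dedup_candidates:
  assumes "es \<noteq> []"
  shows "computes 12 [enc_list (map (\<lambda>v. enc_set es (inc (set es) w \<inter> inc (set es) v)) vs)]
     (enc_list (map (\<lambda>p. enc_candidate es (snd p)) (candidates (set es) vs w)))
     (800 * (length es + 1) * (length vs + 1)\<^sup>2)"
proof -
  let ?cols = "map (\<lambda>v. Some (inc (set es) w \<inter> inc (set es) v)) vs"
  have "inj_on (enc_candidate es) (insert None (set ?cols))"
    by (rule inj_on_enc_candidate[OF assms]) (use inc_subset in fastforce)
  then have "map (enc_candidate es) (dedup None ?cols) = dedup Leaf (map (enc_candidate es) ?cols)"
    by (simp only: map_dedup enc_candidate.simps)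
  also have "map (enc_candidate es) ?cols =
      map (\<lambda>v. enc_set es (inc (set es) w \<inter> inc (set es) v)) vs" (is "_ = ?trees")
    by simp
  finally have "map (enc_candidate es) (map snd (candidates (set es) vs w)) = dedup Leaf ?trees"
    by (simp add: candidates_def)
  then have out: "dedup Leaf ?trees =
      map (\<lambda>p. enc_candidate es (snd p)) (candidates (set es) vs w)"
    by (simp add: comp_def)
  have "computes 12 [enc_list ?trees] (enc_list (dedup Leaf ?trees))
      (200 * (2 * (2 * length es) + 1) * (length ?trees + 1)\<^sup>2)"
    by (rule computes_Dedup) (simp add: size_enc_set)
  moreover have "200 * (2 * (2 * length es) + 1) * (length ?trees + 1)\<^sup>2 \<le>
      800 * (length es + 1) * (length vs + 1)\<^sup>2"
    unfolding length_map by (intro mult_le_mono1) simp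
  ultimately show ?thesis unfolding out by (rule computes_mono)
qed

text \<open>Surviving traces are distinct subsets of \<open>inc E w\<close>, however many vertices
  there are.\<close>

lemma number_of_candidates:
  assumes "finite (inc E w)"
  shows "length (filter (\<lambda>p. snd p \<noteq> None) (candidates E vs w)) \<le> 2 ^ card (inc E w)"
proof -
  let ?cols = "map (\<lambda>v. Some (inc E w \<inter> inc E v)) vs"
  have "length (filter (\<lambda>p. snd p \<noteq> None) (candidates E vs w)) =
      length (filter (\<lambda>x. x \<noteq> None) (map snd (candidates E vs w)))"
    by (simp add: filter_map comp_def)
  also have "map snd (candidates E vs w) = dedup None ?cols"
    by (simp add: candidates_def)
  also have "length (filter (\<lambda>x. x \<noteq> None) (dedup None ?cols)) \<le> card (set ?cols - {None})"
    by (rule length_filter_dedup)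
  also have "\<dots> \<le> card (Some ` Pow (inc E w))"
    using assms by (intro card_mono) auto
  also have "\<dots> = 2 ^ card (inc E w)"
    using assms by (simp add: card_image card_Pow)
  finally show ?thesis .
qed

section \<open>Logarithmic depth and the loop over all vertices\<close>

lemma less_two_power_bits: "n < 2 ^ length (bits n)"
proof (induction n rule: less_induct)
  case (less n)
  show ?case
  proof (cases "n = 0")
    case False
    then have "n div 2 < 2 ^ length (bits (n div 2))" by (intro less) auto
    then show ?thesis using False by (simp add: bits.simps[of n])
  qed (simp add: bits.simps)
qed

text \<open>\<open>length (bits n)\<close> serves as an integer logarithm. That n lies below its
  power of two supplies the initial search depth; this converse keeps the final exponent within d
  log d.\<close>

lemma two_power_bits_le: "n > 0 \<Longrightarrow> 2 ^ length (bits n) \<le> 2 * n"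
proof (induction n rule: less_induct)
  case (less n)
  show ?case
  proof (cases "n div 2 = 0")
    case True
    then have "n = 1" using less.prems by auto
    then show ?thesis by (simp add: bits.simps)
  next
    case False
    then have "2 ^ length (bits (n div 2)) \<le> 2 * (n div 2)" using less by auto
    also have "\<dots> \<le> n" by simp
    finally show ?thesis using less.prems by (simp add: bits.simps[of n])
  qed
qed

text \<open>The base \<open>2 ^ (d + 1)\<close> bounds the number of traces plus 1, and
  \<open>length (bits d)\<close> is the depth of the search.\<close>

definition branch_bound :: "nat \<Rightarrow> nat" where
  "branch_bound d = 2 ^ ((d + 1) * length (bits d))"

lemma computes_Loop:
  assumes "distinct vs" "\<And>v. v \<in> set ws \<Longrightarrow> card (inc (set es) v) \<le> d"
  shows "computes 17 [enc_list (map (\<lambda>v. enc_set es (inc (set es) v)) ws),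
       enc_list (map (\<lambda>v. enc_set es (inc (set es) v)) vs), unary u]
     (enc_answer vs (scan (set es) vs u ws))
     (3000 * ((length es + 1) ^ 3 * (length vs + 1)\<^sup>2 * branch_bound d) * (length ws + 1))"
  using assms(2)
proof (induction ws)
  case Nil
  define Q where "Q = (length es + 1) ^ 3 * (length vs + 1)\<^sup>2 * branch_bound d"
  have "1 * 1 * 1 \<le> Q" unfolding Q_def branch_bound_def by (intro mult_le_mono one_le_power) auto
  then show ?case unfolding Q_def[symmetric]
    by (intro computesI) (auto simp: loop_body_def)
next
  case (Cons w ws)
  define Q where "Q = (length es + 1) ^ 3 * (length vs + 1)\<^sup>2 * branch_bound d"
  define X where "X = 3000 * Q * (length ws + 1)"
  let ?cols = "enc_list (map (\<lambda>v. enc_set es (inc (set es) v)) vs)"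
  let ?m = "inc (set es) w"
  have bb: "1 \<le> branch_bound d" unfolding branch_bound_def by (rule one_le_power) simp
  have e1: "1 \<le> (length es + 1) ^ 3" "length es + 1 \<le> (length es + 1) ^ 3"
    by (rule one_le_power, simp) (rule self_le_power, auto)
  have n1: "1 \<le> (length vs + 1)\<^sup>2" "length vs + 1 \<le> (length vs + 1)\<^sup>2"
    by (rule one_le_power, simp) (rule self_le_power, auto)
  have "1 * 1 * 1 \<le> Q" unfolding Q_def by (intro mult_le_mono e1 n1 bb)
  then have Q1: "1 \<le> Q" by simp
  have "(length es + 1) * 1 * 1 \<le> Q" unfolding Q_def by (intro mult_le_mono e1 n1 bb)
  then have Q2: "length es + 1 \<le> Q" by simp
  have "(length es + 1) * (length vs + 1) * 1 \<le> Q" unfolding Q_def by (intro mult_le_mono e1 n1 bb)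
  then have Q3: "100 * (length es + 1) * (length vs + 1) \<le> 100 * Q" by (simp add: algebra_simps)
  have "(length es + 1) * (length vs + 1)\<^sup>2 * 1 \<le> Q"
    unfolding Q_def by (intro mult_le_mono e1 n1 bb order_refl)
  then have Q4: "800 * (length es + 1) * (length vs + 1)\<^sup>2 \<le> 800 * Q" by (simp add: algebra_simps)
  have IH: "computes 17 [enc_list (map (\<lambda>v. enc_set es (inc (set es) v)) ws), ?cols, unary u]
     (enc_answer vs (scan (set es) vs u ws)) X"
    unfolding X_def Q_def by (rule Cons.IH) (use Cons.prems in auto)
  have any: "computes 9 [enc_set es ?m] (enc_bool (?m \<noteq> {})) (50 * Q)"
  proof -
    have "?m \<inter> set es = ?m" using inc_subset by fast
    with computes_Any[of es ?m] have "computes 9 [enc_set es ?m] (enc_bool (?m \<noteq> {})) (50 * (length es + 1))"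
      by (simp only:)
    then show ?thesis by (rule computes_mono) (use Q2 in simp)
  qed
  define r where "r = (if ?m \<noteq> {} then search (candidates (set es) vs w) [] ?m u else None)"
  have first: "computes 16 [enc_answer vs r, enc_answer vs (scan (set es) vs u ws)]
      (enc_answer vs (scan (set es) vs u (w # ws))) 10"
    using computes_First[of "enc_answer vs r" "enc_answer vs (scan (set es) vs u ws)"]
    by (cases r) (simp_all add: r_def)
  \<comment> \<open>Of the 3000 Q allowed per vertex, 50, 100, 800 and 1000 times Q go to the
    emptiness test, the restriction, the deduplication and the search; the remainder covers constant
    overhead.\<close>
  have X: "X + 3000 * Q \<le> 3000 * Q * (length (w # ws) + 1)" by (simp add: X_def algebra_simps)
  define Y where "Y = 3000 * Q * (length (w # ws) + 1)"
  note X = X[folded Y_def]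
  define a where "a = enc_answer vs (scan (set es) vs u (w # ws))"
  note first = first[folded a_def]
  have "computes 17 [enc_list (map (\<lambda>v. enc_set es (inc (set es) v)) (w # ws)), ?cols, unary u] a Y"
  proof (cases "?m = {}")
    case True
    then have r: "enc_answer vs r = Leaf" by (simp add: r_def)
    show ?thesis
      apply (intro computesI)
       apply simp
      apply (simp add: loop_body_def)
      apply (rule wpcI[OF any])
      apply (simp add: True)
      apply (rule wpcI[OF IH])
      apply (rule wpcI[OF first[unfolded r]])
      using X Q1 apply simp
      done
  next
    case False
    have es: "es \<noteq> []" using False by (auto simp: inc_def)
    have fin: "finite ?m" using inc_subset by (rule finite_subset) simp
    have restrict: "computes 13 [enc_set es ?m, ?cols]
        (enc_list (map (\<lambda>v. enc_set es (?m \<inter> inc (set es) v)) vs)) (100 * Q)"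
      by (rule computes_mono[OF computes_Restrict Q3])
    have dedup: "computes 12 [enc_list (map (\<lambda>v. enc_set es (?m \<inter> inc (set es) v)) vs)]
       (enc_list (map (\<lambda>p. enc_candidate es (snd p)) (candidates (set es) vs w))) (800 * Q)"
      by (rule computes_mono[OF computes_Dedup_candidates[OF es] Q4])
    let ?D = "length (filter (\<lambda>p. snd p \<noteq> None) (candidates (set es) vs w))"
    let ?b = "length (bits d)"
    have cm: "card ?m \<le> d" using Cons.prems by simp
    have "computes 15 [enc_list (map (\<lambda>p. enc_candidate es (snd p)) (candidates (set es) vs w)),
        enc_list (map (enc_set es) []), enc_set es ?m, unary u]
      (enc_answer (map fst (candidates (set es) vs w)) (search (candidates (set es) vs w) [] ?m u))
      (1000 * (length es + 1) ^ 3 * (length (candidates (set es) vs w) + 1) * (?D + 1) ^ ?b)"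
    proof (rule computes_Search)
      \<comment> \<open>The search starts from the empty family, so its depth only has to push
        \<open>2 ^ depth\<close> above the degree.\<close>
      show "card ?m < 2 ^ (length [] + ?b)" using cm less_two_power_bits[of d] by simp
    qed (use inc_subset[of "set es" w] es False assms(1) in auto)
    moreover have "1000 * (length es + 1) ^ 3 * (length (candidates (set es) vs w) + 1) * (?D + 1) ^ ?b
        \<le> 1000 * Q"
    proof -
      \<comment> \<open>The extra 1 is absorbed by doubling, whence d + 1 rather than d in
        \<open>branch_bound\<close>.\<close>
      have "?D + 1 \<le> 2 ^ card ?m + 2 ^ card ?m"
        using number_of_candidates[OF fin, of vs] one_le_power[of 2 "card ?m"]
        by (intro add_mono) auto
      also have "\<dots> \<le> 2 ^ d + 2 ^ d" using cm by (intro add_mono power_increasing) auto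
      also have "\<dots> = 2 ^ (d + 1)" by simp
      finally have "(?D + 1) ^ ?b \<le> (2 ^ (d + 1)) ^ ?b" by (rule power_mono) simp
      then have "(?D + 1) ^ ?b \<le> branch_bound d"
        unfolding branch_bound_def power_mult .
      moreover have "length (candidates (set es) vs w) = length vs"
        by (simp add: candidates_def)
      ultimately have "1000 * ((length es + 1) ^ 3 * (length (candidates (set es) vs w) + 1) * (?D + 1) ^ ?b)
        \<le> 1000 * Q"
        unfolding Q_def by (intro mult_le_mono order_refl) (use n1 in simp_all)
      then show ?thesis by (simp only: mult.assoc)
    qed
    ultimately have search: "computes 15 [enc_list (map (\<lambda>p. enc_candidate es (snd p)) (candidates (set es) vs w)),
        Leaf, enc_set es ?m, unary u] (enc_answer vs r) (1000 * Q)"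
      using False computes_mono by (simp add: r_def)
    show ?thesis
      apply (intro computesI)
       apply simp
      apply (simp add: loop_body_def)
      apply (rule wpcI[OF any])
      apply (simp add: False)
      apply (rule wpcI[OF restrict])
      apply (rule wpcI[OF dedup])
      apply (rule wpcI[OF search])
      apply (rule wpcI[OF IH])
      apply (rule wpcI[OF first])
      using X Q1 apply simp
      done
  qed
  then show ?case unfolding a_def Y_def Q_def .
qed

section \<open>The complete program\<close>

definition answer :: "'a set list \<Rightarrow> 'a list \<Rightarrow> nat \<Rightarrow> 'a set option" where
  "answer es vs k = (if k \<le> length vs + 1 then scan (set es) vs (k - 1) vs else None)"

lemma computes_main:
  assumes "distinct vs" "k > 0" "\<And>v. v \<in> set vs \<Longrightarrow> card (inc (set es) v) \<le> d"
  shows "computes 0 [enc_instance vs es k] (enc_answer vs (answer es vs k))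
     (10000 * ((length es + 1) ^ 3 * (length vs + 1) ^ 3 * branch_bound d))"
proof -
  define Q where "Q = (length es + 1) ^ 3 * (length vs + 1) ^ 3 * branch_bound d"
  have bb: "1 \<le> branch_bound d" unfolding branch_bound_def by (rule one_le_power) simp
  have e1: "1 \<le> (length es + 1) ^ 3" "length es + 1 \<le> (length es + 1) ^ 3"
    by (rule one_le_power, simp) (rule self_le_power, auto)
  have n1: "1 \<le> (length vs + 1) ^ 3" "length vs + 1 \<le> (length vs + 1) ^ 3"
    "(length vs + 1)\<^sup>2 \<le> (length vs + 1) ^ 3"
    by (rule one_le_power, simp) (rule self_le_power, simp, simp, rule power_increasing, auto)
  have "1 * 1 * 1 \<le> Q" unfolding Q_def by (intro mult_le_mono e1 n1 bb)
  then have Q1: "1 \<le> Q" by simp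
  have "(length es + 1) * (length vs + 1) * 1 \<le> Q" unfolding Q_def by (intro mult_le_mono e1 n1 bb)
  then have Q2: "100 * (length vs + 1) * (length es + 1) \<le> 100 * Q" by (simp add: algebra_simps)
  have "1 * (length vs + 1)\<^sup>2 * 1 \<le> Q" unfolding Q_def by (intro mult_le_mono e1 n1 bb)
  moreover have "500 * (length vs + 1) * (1 + length vs + 1) \<le> 500 * (length vs + 1) * (2 * (length vs + 1))"
    by (intro mult_le_mono) auto
  ultimately have Q3: "500 * (length vs + 1) * (1 + length vs + 1) \<le> 1000 * Q"
    by (simp add: power2_eq_square algebra_simps)
  let ?cols = "enc_list (map (\<lambda>v. enc_set es (inc (set es) v)) vs)"
  have columns: "computes 6 [enc_list (map (\<lambda>_. Leaf) vs), enc_list (map (enc_set vs) es)] ?cols (100 * Q)"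
    by (rule computes_mono[OF computes_Columns Q2])
  define c where "c = (if k \<le> length vs + 1 then Node Leaf (unary (k - 1)) else Leaf)"
  \<comment> \<open>Counting from 1 with an empty accumulator yields k - 1, the size to search for,
    directly in unary. With one unit of fuel per vertex it recognises every k up to
    \<open>length vs + 1\<close>.\<close>
  have "computes 3 [unary (length vs), enc_nat 1, unary 0, enc_nat k] c (1000 * Q)"
    using computes_mono[OF computes_Count[of "length vs" 1 0 k] Q3] assms(2)
    by (cases "k \<le> length vs + 1") (simp_all add: c_def)
  then have count: "computes 3 [enc_list (map (\<lambda>_. Leaf) vs), Node (Node Leaf Leaf) Leaf, Leaf, enc_nat k]
      c (1000 * Q)"
    by (simp add: enc_nat_pos map_replicate_const)
  have loop: "computes 17 [?cols, ?cols, unary u] (enc_answer vs (scan (set es) vs u vs)) (3000 * Q)" for u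
  proof (rule computes_mono[OF computes_Loop[OF assms(1,3)]])
    show "3000 * ((length es + 1) ^ 3 * (length vs + 1)\<^sup>2 * branch_bound d) * (length vs + 1) \<le> 3000 * Q"
      unfolding Q_def by (simp only: power2_eq_square power3_eq_cube mult_ac order_refl)
  qed
  define a where "a = enc_answer vs (answer es vs k)"
  have start: "computes 18 [?cols, c] a (3500 * Q)"
  proof (cases "k \<le> length vs + 1")
    case True
    have "enc_answer vs (scan (set es) vs (k - 1) vs) = a" using True by (simp add: a_def answer_def)
    note loop' = loop[of "k - 1", unfolded this]
    have c: "c = Node Leaf (unary (k - 1))" using True by (simp add: c_def)
    show ?thesis unfolding c
      apply (intro computesI)
       apply simp
      apply (simp add: start_body_def)
      apply (rule wpcI[OF loop'[simplified]])
      using Q1 apply simp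
      done
  next
    case False
    then have "c = Leaf" "a = Leaf" by (auto simp: c_def a_def answer_def)
    then show ?thesis using Q1 by (intro computesI) (auto simp: start_body_def)
  qed
  show ?thesis unfolding Q_def[symmetric] a_def[symmetric]
    apply (intro computesI)
     apply simp
    apply (simp add: main_body_def enc_instance_def)
    apply (rule wpcI[OF columns])
    apply (rule wpcI[OF count])
    apply (rule wpcI[OF start])
    using Q1 apply simp
    done
qed

text \<open>If the counter gave up, k exceeds the number of vertices and \<open>None\<close> is
  right without any search. Otherwise \<open>scan\<close> decides, and completeness for k = Suc (k -
  1) relies on k > 0.\<close>

lemma answer_correct:
  assumes "distinct vs" "k > 0"
  shows "case answer es vs k of
      Some S \<Rightarrow> shattered (set vs) (set es) S \<and> card S = k - 1
    | None \<Rightarrow> \<not> (\<exists>S. shattered (set vs) (set es) S \<and> card S = k)"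
proof (cases "answer es vs k")
  case None
  have "False" if S: "shattered (set vs) (set es) S" "card S = k" for S
  proof -
    have "S \<subseteq> set vs" using S(1) by (simp add: shattered_def)
    then have "card S \<le> length vs" using card_mono[of "set vs" S] card_length[of vs] by simp
    moreover have "scan (set es) vs (k - 1) vs \<noteq> None"
      by (rule scan_complete[OF S(1)]) (use S(2) assms(2) in simp)
    ultimately show False using None S(2) by (simp add: answer_def)
  qed
  then show ?thesis using None by auto
next
  case (Some S)
  then have "scan (set es) vs (k - 1) vs = Some S" by (auto simp: answer_def split: if_splits)
  from scan_sound[OF this assms(1)] show ?thesis using Some by simp
qed

section \<open>The final time bound\<close>

lemma card_inc_le_max_degree: "finite V \<Longrightarrow> v \<in> V \<Longrightarrow> card (inc E v) \<le> max_degree V E"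
  unfolding max_degree_def by (intro Max_ge) auto

text \<open>The summand 20 carries the constant factor of the running time. It also keeps the
  exponent positive for degrees 0 and 1, where d log d vanishes.\<close>

lemma exponent_bigo:
  "(\<lambda>d. real (20 + (d + 1) * length (bits d))) \<in> O(\<lambda>d. real d * log 2 (real d))"
proof (rule bigoI)
  show "\<forall>\<^sub>F d in at_top. norm (real (20 + (d + 1) * length (bits d))) \<le>
      24 * norm (real d * log 2 (real d))"
  proof (rule eventually_mono[OF eventually_ge_at_top[of 2]])
    \<comment> \<open>From 2 on the logarithm is at least 1. Then d + 1 and the number of bits are
      at most twice d and twice log d, which gives 4 d log d, and the constant contributes at most
      20 d log d.\<close>
    fix d :: nat assume d: "2 \<le> d"
    have log1: "1 \<le> log 2 (real d)" using d by simp
    have "2 powr real (length (bits d)) \<le> 2 * real d"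
      using two_power_bits_le[of d] d
      by (simp add: powr_realpow) (metis of_nat_le_iff of_nat_mult of_nat_numeral of_nat_power)
    then have "real (length (bits d)) \<le> log 2 (2 * real d)"
      using d by (subst le_log_iff) auto
    also have "\<dots> = 1 + log 2 (real d)" using d by (subst log_mult) auto
    finally have bits: "real (length (bits d)) \<le> 2 * log 2 (real d)" using log1 by linarith
    have "real (d + 1) * real (length (bits d)) \<le> (2 * real d) * (2 * log 2 (real d))"
      using d bits by (intro mult_mono) auto
    moreover have "1 * 1 \<le> real d * log 2 (real d)" using d log1 by (intro mult_mono) auto
    ultimately have "real (20 + (d + 1) * length (bits d)) \<le> 24 * (real d * log 2 (real d))"
      by (simp add: algebra_simps)
    then show "norm (real (20 + (d + 1) * length (bits d))) \<le> 24 * norm (real d * log 2 (real d))"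
      using log1 by simp
  qed
qed

theorem theorem2:
  "\<exists>(P :: program) (f :: nat \<Rightarrow> real) (c :: nat).
     f \<in> O(\<lambda>d. real d * log 2 (real d)) \<and>
     (\<forall>(V :: nat set) (E :: nat set set) (vs :: nat list) (es :: nat set list) (k :: nat).
        hypergraph V E \<and> distinct vs \<and> set vs = V \<and> distinct es \<and> set es = E \<and> k > 0 \<longrightarrow>
        (\<exists>(answer :: nat set option) (t :: nat).
           run P (enc_instance vs es k) (enc_answer vs answer) t \<and>
           real t \<le> 2 powr f (max_degree V E) * real (max 1 (hsize V E)) ^ c \<and>
           (case answer of
              Some S \<Rightarrow> shattered V E S \<and> card S = k - 1
            | None \<Rightarrow> \<not> (\<exists>S. shattered V E S \<and> card S = k))))"
proof (rule exI[of _ prog], rule exI[of _ "\<lambda>d. real (20 + (d + 1) * length (bits d))"],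
    rule exI[of _ 6], intro conjI exponent_bigo allI impI)
  fix V :: "nat set" and E :: "nat set set" and vs :: "nat list" and es :: "nat set list" and k :: nat
  assume *: "hypergraph V E \<and> distinct vs \<and> set vs = V \<and> distinct es \<and> set es = E \<and> k > 0"
  let ?d = "max_degree V E" and ?N = "max 1 (hsize V E)"
  define T where "T = 10000 * ((length es + 1) ^ 3 * (length vs + 1) ^ 3 * branch_bound ?d)"
  \<comment> \<open>Vertex and hyperedge count plus 1 are each at most 2 N, also for the empty
    hypergraph thanks to the maximum with 1. Their cubes give \<open>N ^ 6\<close> and the factor
    64.\<close>
  have N: "length vs + 1 \<le> 2 * ?N" "length es + 1 \<le> 2 * ?N"
    using * distinct_card[of vs] distinct_card[of es] by (auto simp: hsize_def max_def)
  have "computes 0 [enc_instance vs es k] (enc_answer vs (answer es vs k)) T"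
    unfolding T_def by (rule computes_main) (use * in \<open>auto intro: card_inc_le_max_degree\<close>)
  then have "wpc prog 0 [enc_instance vs es k] (\<lambda>v t. v = enc_answer vs (answer es vs k) \<and> t \<le> T)"
    by (simp add: computes_def)
  \<comment> \<open>The 2 extra units are the lookup of the argument and the call itself.\<close>
  then have "wp prog [enc_instance vs es k] (Call 0 [Arg 0])
      (\<lambda>v t. v = enc_answer vs (answer es vs k) \<and> t \<le> T + 2)"
    by simp
  then obtain t where t: "run prog (enc_instance vs es k) (enc_answer vs (answer es vs k)) t" "t \<le> T + 2"
    unfolding wp_def run_def by blast
  define Z where "Z = ?N ^ 6 * branch_bound ?d"
  have "T \<le> 10000 * ((2 * ?N) ^ 3 * (2 * ?N) ^ 3 * branch_bound ?d)"
    unfolding T_def by (intro mult_le_mono power_mono N order_refl) auto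
  also have "\<dots> = 640000 * Z"
    by (simp add: Z_def power_mult_distrib power_add[symmetric])
  finally have "T \<le> 640000 * Z" .
  moreover have "1 * 1 \<le> Z"
    unfolding Z_def branch_bound_def by (intro mult_le_mono one_le_power) auto
  \<comment> \<open>\<open>2 ^ 20\<close> is 1048576, more than 640000 + 2, and Z is at least
    1.\<close>
  ultimately have "t \<le> 2 ^ 20 * Z" using t(2) by simp
  also have "\<dots> = 2 ^ (20 + (?d + 1) * length (bits ?d)) * ?N ^ 6"
    by (simp add: Z_def branch_bound_def power_add)
  finally have "real t \<le> real (2 ^ (20 + (?d + 1) * length (bits ?d)) * ?N ^ 6)"
    by (simp only: of_nat_le_iff)
  also have "\<dots> = 2 powr real (20 + (?d + 1) * length (bits ?d)) * real ?N ^ 6"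
    by (simp only: of_nat_mult of_nat_power of_nat_numeral powr_realpow[OF zero_less_numeral])
  finally show "\<exists>(answer :: nat set option) (t :: nat).
           run prog (enc_instance vs es k) (enc_answer vs answer) t \<and>
           real t \<le> 2 powr real (20 + (?d + 1) * length (bits ?d)) * real ?N ^ 6 \<and>
           (case answer of
              Some S \<Rightarrow> shattered V E S \<and> card S = k - 1
            | None \<Rightarrow> \<not> (\<exists>S. shattered V E S \<and> card S = k))"
    using t(1) answer_correct[of vs k es] * by (intro exI[of _ "answer es vs k"] exI[of _ t]) auto
qed

end
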